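(* Let $b\in\mathbb{N}$, $b\ge2$, and let $P_n$ be the internal path length of a random linear recursive tree of size $n$ with weight function $u\mapsto1+(b-2)\deg(u)$. Let $\gamma\approx2.0047$ be the positive solution of $12/7=e^{2/\gamma}-2/\gamma$ and $L_0\approx5.0177$ the largest root of $e^L=6L^2$. Then there exists $D>0$ such that, with $C:=48D/\gamma+D\sqrt{48(48/\gamma^2-5)}$, for all $t>0$ and $n\in\mathbb{N}$ both $$P\left(\frac{P_n-E[P_n]}{n}>t\right)\quad\text{and}\quad P\left(\frac{P_n-E[P_n]}{n}<-t\right)$$ are at most $$\begin{cases} \exp\left(-\frac{t^2}{10\gamma^2D^2}\right),&\text{if }0\le t\le 5\gamma D,\\ \exp\left(\frac52-\frac{t}{\gamma D}\right),&\text{if }5\gamma D<t\le C,\\ \exp\left(-\frac{t^2}{96D^2}\right),&\text{if }C<t\le 48DL_0,\\ \exp\left(24L_0^2-\frac{L_0}{D}t\right),&\text{if }48DL_0<t\le 4De^{L_0},\\ \exp\left(\frac tD-\frac tD\log\left(\frac{t}{4D}\right)\right),&\text{if }4De^{L_0}<t, \end{cases}$$ and in particular, for every $t>0$, as $n\to\infty$, $$P\left(|P_n-E[P_n]|>tE[P_n]\right)\le\exp\left(-\frac1{b-1}\frac1D\,t\log n\left(\log^{(2)}n+\log t+\alpha+o(1)\right)\right)$$ with $\alpha:=-\log\left(4D(b-1)e\right)$.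
   Context: Random linear recursive tree: the tree starts with the root and grows node by node; in each step the new node is attached as a child to a randomly chosen existing node, where node $u$ is chosen with probability proportional to its current weight $w_u=1+\beta\deg(u)$. Here $\deg(u)$ is the current number of children of $u$ and $\beta\ge0$ is the parameter of the tree (in this statement $\beta=b-2$). The depth of a node is the number of edges on the path from it to the root; the internal path length $P_n$ is the sum of the depths of all $n$ nodes. $\log^{(2)}n=\log\log n$; the $o(1)$ is for $n\to\infty$ with $t$ fixed. *)

theory Defs
  imports "HOL-Probability.Probability"
begin

text \<open>A rooted tree whose nodes \<open>0, \<dots>, k\<close> are numbered in order of insertion (the root is \<open>0\<close>)
  is encoded by the list of parents of the nodes \<open>1, \<dots>, k\<close>. In particular \<open>[]\<close> is the
  tree that consists only of its root.\<close>

type_synonym inc_tree = "nat list"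

definition nodes :: "inc_tree \<Rightarrow> nat set" where
  "nodes T = {..length T}"

definition parent :: "inc_tree \<Rightarrow> nat \<Rightarrow> nat" where
  "parent T u = T ! (u - 1)"

definition deg :: "inc_tree \<Rightarrow> nat \<Rightarrow> nat" where
  "deg T u = card {v \<in> nodes T. v \<noteq> 0 \<and> parent T v = u}"

definition depth :: "inc_tree \<Rightarrow> nat \<Rightarrow> nat" where
  "depth T u = (LEAST k. (parent T ^^ k) u = 0)"

definition internal_path_length :: "inc_tree \<Rightarrow> nat" where
  "internal_path_length T = (\<Sum>u\<in>nodes T. depth T u)"

definition weight :: "real \<Rightarrow> inc_tree \<Rightarrow> nat \<Rightarrow> real" where
  "weight \<beta> T u = 1 + \<beta> * real (deg T u)"

definition parent_pmf :: "real \<Rightarrow> inc_tree \<Rightarrow> nat pmf" where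
  "parent_pmf \<beta> T = embed_pmf
     (\<lambda>u. if u \<in> nodes T then weight \<beta> T u / (\<Sum>v\<in>nodes T. weight \<beta> T v) else 0)"

primrec grow :: "real \<Rightarrow> nat \<Rightarrow> inc_tree pmf" where
  "grow \<beta> 0 = return_pmf []"
| "grow \<beta> (Suc k) =
     bind_pmf (grow \<beta> k) (\<lambda>T. map_pmf (\<lambda>u. T @ [u]) (parent_pmf \<beta> T))"

text \<open>Meaningful for sizes \<open>n \<ge> 1\<close>: a tree of size \<open>n\<close> arises from the root by
  \<open>n - 1\<close> insertions.\<close>

definition linear_recursive_tree :: "real \<Rightarrow> nat \<Rightarrow> inc_tree pmf" where
  "linear_recursive_tree \<beta> n = grow \<beta> (n - 1)"

definition mean_path_length :: "real \<Rightarrow> nat \<Rightarrow> real" where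
  "mean_path_length \<beta> n =
     measure_pmf.expectation (linear_recursive_tree \<beta> n) (\<lambda>T. real (internal_path_length T))"

text \<open>For \<open>D > 0\<close> and the constants \<open>\<gamma> \<approx> 2.0047\<close>, \<open>L\<^sub>0 \<approx> 5.0177\<close> the four thresholds are
  increasing (about \<open>10 D < 42 D < 241 D < 604 D\<close>), so each branch is one of five consecutive
  intervals. The function is used for \<open>t > 0\<close> only.\<close>

definition tail_bound :: "real \<Rightarrow> real \<Rightarrow> real \<Rightarrow> real \<Rightarrow> real" where
  "tail_bound \<gamma> L\<^sub>0 D t =
    (let C = 48 * D / \<gamma> + D * sqrt (48 * (48 / \<gamma>\<^sup>2 - 5)) in
     if t \<le> 5 * \<gamma> * D then exp (- (t\<^sup>2 / (10 * \<gamma>\<^sup>2 * D\<^sup>2)))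
     else if t \<le> C then exp (5 / 2 - t / (\<gamma> * D))
     else if t \<le> 48 * D * L\<^sub>0 then exp (- (t\<^sup>2 / (96 * D\<^sup>2)))
     else if t \<le> 4 * D * exp L\<^sub>0 then exp (24 * L\<^sub>0\<^sup>2 - L\<^sub>0 / D * t)
     else exp (t / D - t / D * ln (t / (4 * D))))"

text \<open>The encoding behaves as intended: \<open>embed_pmf\<close> is applied to a genuine mass function,
  the trees have the right size with parents older than their children, and the depth increases by
  one along each edge.\<close>

lemma weight_pos: "\<beta> \<ge> 0 \<Longrightarrow> weight \<beta> T u > 0"
  unfolding weight_def by (simp add: add_pos_nonneg)

lemma pmf_parent_pmf:
  assumes "\<beta> \<ge> 0"
  shows "pmf (parent_pmf \<beta> T) u =
    (if u \<in> nodes T then weight \<beta> T u / (\<Sum>v\<in>nodes T. weight \<beta> T v) else 0)"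
  unfolding parent_pmf_def
proof (rule pmf_embed_pmf)
  let ?S = "\<Sum>v\<in>nodes T. weight \<beta> T v"
  let ?f = "\<lambda>u. if u \<in> nodes T then weight \<beta> T u / ?S else 0"
  have fin: "finite (nodes T)" "nodes T \<noteq> {}"
    by (auto simp: nodes_def)
  have S: "?S > 0"
    using fin weight_pos[OF assms] by (intro sum_pos) auto
  show nonneg: "0 \<le> ?f x" for x
    using weight_pos[OF assms, of T x] S by auto
  have "(\<integral>\<^sup>+x. ennreal (?f x) \<partial>count_space UNIV) = (\<Sum>x\<in>nodes T. ennreal (?f x))"
    using fin by (intro nn_integral_count_space') auto
  also have "\<dots> = ennreal (\<Sum>x\<in>nodes T. ?f x)"
    using nonneg by (intro sum_ennreal)
  also have "(\<Sum>x\<in>nodes T. ?f x) = 1"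
    using S by (simp add: sum_divide_distrib [symmetric])
  finally show "(\<integral>\<^sup>+x. ennreal (?f x) \<partial>count_space UNIV) = 1"
    by simp
qed

lemma set_pmf_grow:
  assumes "\<beta> \<ge> 0" and "T \<in> set_pmf (grow \<beta> k)"
  shows "length T = k \<and> (\<forall>i<k. T ! i \<le> i)"
  using assms(2)
proof (induction k arbitrary: T)
  case (Suc k)
  then obtain T' u where T: "T = T' @ [u]" "T' \<in> set_pmf (grow \<beta> k)" "u \<in> set_pmf (parent_pmf \<beta> T')"
    by auto
  then have "u \<in> nodes T'"
    by (auto simp: set_pmf_iff pmf_parent_pmf[OF assms(1)] split: if_splits)
  then show ?case
    using Suc.IH[OF T(2)] T(1) by (auto simp: nodes_def nth_append less_Suc_eq)
qed simp

lemma depth_root [simp]: "depth T 0 = 0"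
  unfolding depth_def by (rule Least_equality) auto

lemma depth_nonroot:
  assumes "\<forall>i<length T. T ! i \<le> i" and "u \<in> nodes T" and "u \<noteq> 0"
  shows "depth T u = Suc (depth T (parent T u))"
proof -
  have "\<exists>k. (parent T ^^ k) v = 0" if "v \<in> nodes T" for v
    using that
  proof (induction v rule: less_induct)
    case (less v)
    show ?case
    proof (cases "v = 0")
      case True
      then show ?thesis by (intro exI[of _ 0]) simp
    next
      case False
      then have "v - 1 < length T" using less.prems by (auto simp: nodes_def)
      then have "parent T v \<le> v - 1"
        using assms(1) by (auto simp: parent_def)
      then have "parent T v < v" "parent T v \<in> nodes T"
        using False less.prems by (auto simp: nodes_def)
      then obtain k where "(parent T ^^ k) (parent T v) = 0"
        using less.IH by blast
      then show ?thesis by (intro exI[of _ "Suc k"]) (simp add: funpow_swap1)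
    qed
  qed
  then obtain k where "(parent T ^^ k) u = 0" using assms(2) by blast
  then have "(LEAST k. (parent T ^^ k) u = 0) = Suc (LEAST k. (parent T ^^ Suc k) u = 0)"
    using assms(3) by (intro Least_Suc) auto
  then show ?thesis
    unfolding depth_def by (simp add: funpow_swap1)
qed

text \<open>The two numerical constants exist.\<close>

lemma ex1_gamma: "\<exists>!\<gamma>::real. \<gamma> > 0 \<and> 12 / 7 = exp (2 / \<gamma>) - 2 / \<gamma>"
proof -
  let ?g = "\<lambda>x::real. exp x - x"
  have mono: "?g x < ?g y" if "0 \<le> x" "x < y" for x y
  proof -
    have "exp x * (1 + (y - x)) \<le> exp x * exp (y - x)"
      by (intro mult_left_mono exp_ge_add_one_self) auto
    also have "\<dots> = exp y" by (simp flip: exp_add)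
    finally have "exp x + exp x * (y - x) \<le> exp y" by (simp add: algebra_simps)
    moreover have "y - x \<le> exp x * (y - x)"
      using that by simp
    moreover have "1 + (y - x) < exp (y - x)"
      using that exp_minus_ge[of "-(y-x)"] exp_ge_add_one_self[of "y - x"]
            exp_lower_Taylor_quadratic[of "y - x"] zero_less_power[of "y - x" 2] by linarith
    then have "exp x * (1 + (y - x)) < exp x * exp (y - x)" by simp
    then have "exp x + exp x * (y - x) < exp y"
      by (simp add: algebra_simps flip: exp_add)
    ultimately show ?thesis by simp
  qed
  have "\<exists>x\<ge>0. x \<le> 2 \<and> ?g x = 12 / 7"
  proof (rule IVT')
    show "12 / 7 \<le> exp 2 - (2::real)"
      using exp_lower_Taylor_quadratic[of 2] by simp
  qed (auto intro!: continuous_intros)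
  then obtain x where x: "x \<ge> 0" "?g x = 12 / 7" by blast
  then have "x > 0" by (cases "x = 0") auto
  show ?thesis
  proof (rule ex1I[of _ "2 / x"])
    fix \<gamma> :: real assume \<gamma>: "\<gamma> > 0 \<and> 12 / 7 = exp (2 / \<gamma>) - 2 / \<gamma>"
    then have "\<not> 2 / \<gamma> < x" "\<not> x < 2 / \<gamma>"
      using mono[of "2 / \<gamma>" x] mono[of x "2 / \<gamma>"] x by auto
    then have "2 / \<gamma> = x" by linarith
    then show "\<gamma> = 2 / x" using \<gamma> by auto
  qed (use x \<open>x > 0\<close> in auto)
qed

lemma ex_largest_root: "\<exists>L::real. exp L = 6 * L\<^sup>2 \<and> (\<forall>L'. exp L' = 6 * L'\<^sup>2 \<longrightarrow> L' \<le> L)"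
proof -
  let ?R = "{L::real. exp L = 6 * L\<^sup>2}"
  have "\<exists>x\<ge>-1. x \<le> 0 \<and> exp x - 6 * x\<^sup>2 = (0::real)"
  proof (rule IVT')
    have "exp (-1::real) \<le> 1" by simp
    then show "exp (-1) - 6 * (-1)\<^sup>2 \<le> (0::real)"
      unfolding power2_eq_square by linarith
  qed (auto intro!: continuous_intros)
  then have "?R \<noteq> {}" by auto
  have "closed ?R" by (intro closed_Collect_eq continuous_intros)
  have "L \<le> 384" if "L \<in> ?R" for L
  proof (rule ccontr)
    assume "\<not> L \<le> 384"
    have "L / 4 \<le> exp (L / 4)" using exp_ge_add_one_self[of "L / 4"] by linarith
    then have "(L / 4) ^ 4 \<le> exp (L / 4) ^ 4" using \<open>\<not> L \<le> 384\<close> by (intro power_mono) auto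
    also have "\<dots> = 6 * L\<^sup>2" using that by (simp flip: exp_of_nat_mult)
    finally have "L\<^sup>2 * L\<^sup>2 \<le> 1536 * L\<^sup>2"
      by (simp add: power_divide power4_eq_xxxx power2_eq_square mult.assoc)
    moreover have "L\<^sup>2 > 0" using \<open>\<not> L \<le> 384\<close> by simp
    ultimately have "L\<^sup>2 \<le> 1536" by (rule mult_right_le_imp_le)
    moreover have "384\<^sup>2 < L\<^sup>2" using \<open>\<not> L \<le> 384\<close> by (intro power_strict_mono) auto
    ultimately show False by simp
  qed
  then have bdd: "bdd_above ?R" by (rule bdd_aboveI)
  have "Sup ?R \<in> ?R"
    using closed_contains_Sup[OF \<open>?R \<noteq> {}\<close> bdd \<open>closed ?R\<close>] .
  then show ?thesis
    using cSup_upper[OF _ bdd] by (intro exI[of _ "Sup ?R"]) auto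
qed

end

theory Submission
  imports Defs "HOL-Real_Asymp.Real_Asymp"
begin

text \<open>Write \<open>c = 1 + \<beta> = b - 1\<close>. A tree with \<open>k + 1\<close> nodes always has total weight
  \<open>W k = 1 + c k\<close>, and because every non-root node \<open>v\<close> adds \<open>\<beta>\<close> to the weight of its parent,
  which sits one level higher, the sum \<open>\<Sum>\<^sub>u w\<^sub>u depth(u)\<close> equals \<open>c P - \<beta> k\<close>, where \<open>P\<close> is
  the internal path length. Hence the expected depth of the next node is an affine function of
  \<open>P\<close>, and \<open>M = (P - E[P]) / W k\<close> is a martingale; inserting a node below \<open>u\<close> changes it by
  \<open>(depth(u) - m) / W (k + 1)\<close>, \<open>m\<close> being the weighted mean depth (\<open>deviation_append\<close>).

  Depths are controlled by \<open>\<Sum>\<^sub>u w\<^sub>u exp (z depth(u))\<close>, whose expectation satisfies an explicit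
  recursion and is at most \<open>W k (k + 1) powr (exp z - 1)\<close> (\<open>exponential_depth_moment\<close>). Two
  consequences carry the theorem.

  \<^item> The variance of \<open>M\<close> is bounded uniformly in \<open>k\<close> (\<open>variance_bound\<close>), so the one-sided
    Chebyshev inequality bounds both tails by \<open>v / (v + t\<^sup>2)\<close>.
  \<^item> \<open>P (\<bar>M\<bar> > x) \<le> exp (- x log x / 16)\<close> for all large \<open>x\<close>, uniformly in \<open>k\<close>
    (\<open>deviation_tail\<close>). While the tree has at most about \<open>x ^ 8\<close> nodes, a large \<open>\<bar>M\<bar>\<close> forces a
    node of depth \<open>x / 2\<close>, which is superexponentially unlikely. Afterwards the tree has, except on
    an event of probability \<open>O(exp (- x\<^sup>2 / 2))\<close>, no node deeper than the fourth root of its size.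
    As long as this holds, the conditional exponential moments at rate \<open>log x\<close> have a convergent
    product, and a Chernoff bound applies to the remaining growth.

  The constant \<open>D\<close> is then chosen large. The first four branches of the bound are at least
  \<open>exp (- const (t / D)\<^sup>2)\<close> on a range \<open>t \<le> const D\<close>. There \<open>v / (v + t\<^sup>2)\<close> suffices once \<open>D\<close> is
  large: as functions of \<open>t\<^sup>2\<close>, \<open>1 + t\<^sup>2 / v\<close> is affine and \<open>exp (const (t / D)\<^sup>2)\<close> is convex, they
  agree at \<open>0\<close>, and a large \<open>D\<close> puts them in the right order at the right end of the range. The
  last branch is the second fact above. The bound on the deviation relative to the mean follows
  from the same fact and a logarithmic lower bound for the mean; as \<open>D \<ge> 64 c\<close> leaves a
  constant factor to spare in the exponent, even \<open>\<epsilon> = 0\<close> works.\<close>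

section \<open>Inserting a node\<close>

definition recursive_tree :: "inc_tree \<Rightarrow> bool" where
  "recursive_tree T \<longleftrightarrow> (\<forall>i<length T. T ! i \<le> i)"

lemma finite_nodes [simp]: "finite (nodes T)"
  by (simp add: nodes_def)

lemma recursive_tree_append:
  "recursive_tree (T @ [v]) \<longleftrightarrow> recursive_tree T \<and> v \<in> nodes T"
  by (auto simp: recursive_tree_def nodes_def nth_append less_Suc_eq)

lemma parent_less:
  assumes "recursive_tree T" "u \<in> nodes T" "u \<noteq> 0"
  shows "parent T u < u"
proof -
  have "u - 1 < length T" using assms by (auto simp: nodes_def)
  then have "T ! (u - 1) \<le> u - 1" using assms by (auto simp: recursive_tree_def)
  then show ?thesis using assms by (auto simp: parent_def)
qed

lemma nodes_append: "nodes (T @ [v]) = insert (Suc (length T)) (nodes T)"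
  by (auto simp: nodes_def)

lemma new_not_node: "Suc (length T) \<notin> nodes T"
  by (auto simp: nodes_def)

lemma parent_append_old:
  assumes "u \<in> nodes T" "u \<noteq> 0"
  shows "parent (T @ [v]) u = parent T u"
  using assms by (auto simp: parent_def nodes_def nth_append)

lemma parent_append_new: "parent (T @ [v]) (Suc (length T)) = v"
  by (simp add: parent_def)

lemma depth_append_old:
  assumes "recursive_tree (T @ [v])" "u \<in> nodes T"
  shows "depth (T @ [v]) u = depth T u"
  using assms(2)
proof (induction u rule: less_induct)
  case (less u)
  have T: "recursive_tree T" using assms(1) by (simp add: recursive_tree_append)
  show ?case
  proof (cases "u = 0")
    case False
    have par: "parent T u < u" by (rule parent_less[OF T less.prems False])
    then have mem: "parent T u \<in> nodes T" using less.prems by (auto simp: nodes_def)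
    have "depth (T @ [v]) u = Suc (depth (T @ [v]) (parent (T @ [v]) u))"
      using assms(1) less.prems False
      by (intro depth_nonroot) (auto simp: recursive_tree_def nodes_append)
    also have "\<dots> = Suc (depth T (parent T u))"
      using less.IH[OF par mem] parent_append_old[OF less.prems False] by simp
    also have "\<dots> = depth T u"
      using T less.prems False by (intro depth_nonroot [symmetric]) (auto simp: recursive_tree_def)
    finally show ?thesis .
  qed auto
qed

lemma depth_append_new:
  assumes "recursive_tree (T @ [v])"
  shows "depth (T @ [v]) (Suc (length T)) = Suc (depth T v)"
proof -
  have "depth (T @ [v]) (Suc (length T)) = Suc (depth (T @ [v]) (parent (T @ [v]) (Suc (length T))))"
    using assms by (intro depth_nonroot) (auto simp: recursive_tree_def nodes_append)
  then show ?thesis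
    using depth_append_old[OF assms, of v] assms
    by (simp add: parent_append_new recursive_tree_append)
qed

lemma deg_append_old:
  assumes "u \<in> nodes T"
  shows "deg (T @ [v]) u = deg T u + (if u = v then 1 else 0)"
proof -
  have "{w \<in> nodes (T @ [v]). w \<noteq> 0 \<and> parent (T @ [v]) w = u} =
        {w \<in> nodes T. w \<noteq> 0 \<and> parent T w = u} \<union> (if u = v then {Suc (length T)} else {})"
    by (auto simp: nodes_append parent_append_new parent_append_old new_not_node)
  then show ?thesis
    by (simp add: deg_def card_Un_disjoint new_not_node)
qed

lemma deg_append_new:
  assumes "recursive_tree (T @ [v])"
  shows "deg (T @ [v]) (Suc (length T)) = 0"
proof -
  have "parent (T @ [v]) w < Suc (length T)" if "w \<in> nodes (T @ [v])" "w \<noteq> 0" for w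
    using parent_less[OF assms that] that by (auto simp: nodes_def)
  then have "{w \<in> nodes (T @ [v]). w \<noteq> 0 \<and> parent (T @ [v]) w = Suc (length T)} = {}"
    by force
  then show ?thesis by (simp add: deg_def)
qed

text \<open>The total weight, the expected depth of the next parent, and the exponential moments of the depth
  are all sums of this form, for \<open>g = 1\<close>, \<open>g d = d\<close> and \<open>g d = exp (z d)\<close>.\<close>

definition weighted_sum :: "real \<Rightarrow> (nat \<Rightarrow> real) \<Rightarrow> inc_tree \<Rightarrow> real" where
  "weighted_sum \<beta> g T = (\<Sum>u\<in>nodes T. weight \<beta> T u * g (depth T u))"

text \<open>A new child of \<open>v\<close> has weight \<open>1\<close> one level below \<open>v\<close>, and raises the weight of \<open>v\<close> itself
  by \<open>\<beta>\<close>. All later recursions are instances of this one.\<close>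

lemma weighted_sum_append:
  assumes "recursive_tree (T @ [v])"
  shows "weighted_sum \<beta> g (T @ [v]) =
    weighted_sum \<beta> g T + \<beta> * g (depth T v) + g (Suc (depth T v))"
proof -
  have v: "v \<in> nodes T" using assms by (simp add: recursive_tree_append)
  have "(\<Sum>u\<in>nodes T. weight \<beta> (T @ [v]) u * g (depth (T @ [v]) u)) =
        (\<Sum>u\<in>nodes T. weight \<beta> T u * g (depth T u) + (if u = v then \<beta> * g (depth T u) else 0))"
    by (intro sum.cong)
       (auto simp: weight_def deg_append_old depth_append_old[OF assms] algebra_simps)
  also have "\<dots> = weighted_sum \<beta> g T + \<beta> * g (depth T v)"
    using v by (simp add: sum.distrib weighted_sum_def)
  finally show ?thesis
    by (simp add: weighted_sum_def nodes_append new_not_node depth_append_new[OF assms]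
        weight_def deg_append_new[OF assms])
qed

lemma path_length_append:
  assumes "recursive_tree (T @ [v])"
  shows "internal_path_length (T @ [v]) = internal_path_length T + Suc (depth T v)"
  by (simp add: internal_path_length_def nodes_append new_not_node depth_append_new[OF assms]
      depth_append_old[OF assms])

lemma weighted_sum_Nil: "weighted_sum \<beta> g [] = g 0"
proof -
  have "deg [] 0 = card ({} :: nat set)"
    unfolding deg_def by (rule arg_cong[of _ _ card]) (auto simp: nodes_def)
  then show ?thesis by (simp add: weighted_sum_def nodes_def weight_def)
qed

lemma path_length_Nil: "internal_path_length [] = 0"
  by (simp add: internal_path_length_def nodes_def)

definition total_weight :: "real \<Rightarrow> nat \<Rightarrow> real" where
  "total_weight \<beta> k = 1 + (1 + \<beta>) * real k"

lemma weighted_sum_one: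
  "recursive_tree T \<Longrightarrow> weighted_sum \<beta> (\<lambda>_. 1) T = total_weight \<beta> (length T)"
proof (induction T rule: rev_induct)
  case (snoc v T)
  then show ?case
    by (simp add: weighted_sum_append recursive_tree_append total_weight_def algebra_simps)
qed (simp add: weighted_sum_Nil total_weight_def)

lemma sum_weight:
  "recursive_tree T \<Longrightarrow> (\<Sum>u\<in>nodes T. weight \<beta> T u) = total_weight \<beta> (length T)"
  using weighted_sum_one[of T \<beta>] by (simp add: weighted_sum_def)

text \<open>This identity is the source of the martingale: the depth-weighted sum is an affine function of
  the internal path length, whatever the shape of the tree.\<close>

lemma weighted_sum_depth:
  "recursive_tree T \<Longrightarrow> weighted_sum \<beta> real T =
     (1 + \<beta>) * real (internal_path_length T) - \<beta> * real (length T)"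
proof (induction T rule: rev_induct)
  case (snoc v T)
  then show ?case
    by (simp add: weighted_sum_append path_length_append recursive_tree_append algebra_simps)
qed (simp add: weighted_sum_Nil path_length_Nil)

lemma total_weight_Suc: "total_weight \<beta> (Suc k) = total_weight \<beta> k + (1 + \<beta>)"
  by (simp add: total_weight_def algebra_simps)

section \<open>The random tree\<close>

text \<open>Compares harmonic sums with logarithms in the inductions below.\<close>

lemma inverse_le_ln_diff: "1 / (real k + 2) \<le> ln (real k + 2) - ln (real k + 1)"
proof -
  have "ln ((real k + 1) / (real k + 2)) \<le> (real k + 1) / (real k + 2) - 1"
    by (intro ln_le_minus_one) auto
  then show ?thesis by (simp add: ln_div field_simps)
qed

text \<open>For negative arguments this follows from \<open>1 + x + x\<^sup>2 / 2 \<le> exp x\<close> at \<open>x = - y\<close>, since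
  \<open>(1 - x + x\<^sup>2) (1 + x + x\<^sup>2 / 2) \<ge> 1\<close>.\<close>

lemma exp_le_quadratic: "\<bar>y\<bar> \<le> 1 \<Longrightarrow> exp y \<le> 1 + y + y\<^sup>2" for y :: real
proof (cases "y \<ge> 0")
  case False
  assume "\<bar>y\<bar> \<le> 1"
  define x where "x = - y"
  have x: "x \<ge> 0" using False by (simp add: x_def)
  have "1 \<le> (1 - x + x\<^sup>2) * (1 + x + x\<^sup>2 / 2)"
  proof -
    have "(1 - x + x\<^sup>2) * (1 + x + x\<^sup>2 / 2) = 1 + x\<^sup>2 / 2 + x ^ 3 / 2 + x ^ 4 / 2"
      by (simp add: algebra_simps power_numeral_reduce add_divide_distrib diff_divide_distrib)
    then show ?thesis using x by simp
  qed
  also have "\<dots> \<le> (1 - x + x\<^sup>2) * exp x"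
  proof (rule mult_left_mono)
    have "0 \<le> (1 - x)\<^sup>2 + x" using x by simp
    then show "0 \<le> 1 - x + x\<^sup>2" by (simp add: power2_eq_square algebra_simps)
  qed (rule exp_lower_Taylor_quadratic[OF x])
  finally have "exp (- x) \<le> 1 - x + x\<^sup>2"
    by (simp add: exp_minus inverse_eq_divide pos_divide_le_eq)
  then show ?thesis by (simp add: x_def)
qed (auto intro: exp_bound)

locale tree_growth =
  fixes \<beta> :: real
  assumes beta: "\<beta> \<ge> 0"
begin

abbreviation (input) W :: "nat \<Rightarrow> real" where "W \<equiv> total_weight \<beta>"

abbreviation (input) mean_grow :: "nat \<Rightarrow> (inc_tree \<Rightarrow> real) \<Rightarrow> real" where
  "mean_grow k \<equiv> measure_pmf.expectation (grow \<beta> k)"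

abbreviation (input) prob_grow :: "nat \<Rightarrow> inc_tree set \<Rightarrow> real" where
  "prob_grow k \<equiv> measure_pmf.prob (grow \<beta> k)"

lemma weight_ge_1: "weight \<beta> T u \<ge> 1"
  using beta by (simp add: weight_def)

lemma total_weight_ge: "W k \<ge> real k + 1"
  using beta by (simp add: total_weight_def algebra_simps)

lemma total_weight_le: "W k \<le> (1 + \<beta>) * (real k + 1)"
  using beta by (simp add: total_weight_def algebra_simps)

lemma total_weight_pos: "W k > 0"
  using total_weight_ge[of k] by linarith

lemma support_grow:
  assumes "T \<in> set_pmf (grow \<beta> k)"
  shows "recursive_tree T" "length T = k"
  using set_pmf_grow[OF beta assms] by (auto simp: recursive_tree_def)

lemma set_parent_pmf: "set_pmf (parent_pmf \<beta> T) \<subseteq> nodes T"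
  by (auto simp: set_pmf_iff pmf_parent_pmf[OF beta] split: if_splits)

lemma finite_support_grow [simp]: "finite (set_pmf (grow \<beta> k))"
proof (induction k)
  case (Suc k)
  have "finite (set_pmf (parent_pmf \<beta> T))" for T
    using finite_subset[OF set_parent_pmf] by simp
  with Suc show ?case by auto
qed simp

lemma integrable_grow [simp]: "integrable (measure_pmf (grow \<beta> k)) (f :: inc_tree \<Rightarrow> real)"
  by (rule integrable_measure_pmf_finite) simp

lemma mean_grow_mono:
  assumes "\<And>T. recursive_tree T \<Longrightarrow> length T = k \<Longrightarrow> f T \<le> g T"
  shows "mean_grow k f \<le> mean_grow k g"
  using assms support_grow by (intro integral_mono_AE) (auto simp: AE_measure_pmf_iff)

lemma mean_grow_cong:
  assumes "\<And>T. recursive_tree T \<Longrightarrow> length T = k \<Longrightarrow> f T = g T"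
  shows "mean_grow k f = mean_grow k g"
  using assms support_grow by (intro integral_cong_AE) (auto simp: AE_measure_pmf_iff)

lemma prob_eq_mean: "prob_grow k A = mean_grow k (indicator A)"
  by simp

text \<open>Turns the recursive definition of the law into a finite weighted average over the parent of
  the new node. Together with the two corollaries below this replaces conditional expectations.\<close>

lemma mean_grow_Suc:
  "mean_grow (Suc k) h = mean_grow k (\<lambda>T. (\<Sum>u\<in>nodes T. weight \<beta> T u * h (T @ [u])) / W k)"
proof -
  have inner: "measure_pmf.expectation (map_pmf (\<lambda>u. T @ [u]) (parent_pmf \<beta> T)) h =
      (\<Sum>u\<in>nodes T. weight \<beta> T u * h (T @ [u])) / W k" if "T \<in> set_pmf (grow \<beta> k)" for T
  proof -
    have "measure_pmf.expectation (map_pmf (\<lambda>u. T @ [u]) (parent_pmf \<beta> T)) h =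
       (\<Sum>u\<in>nodes T. h (T @ [u]) * pmf (parent_pmf \<beta> T) u)"
      unfolding integral_map_pmf
      by (rule integral_measure_pmf_real) (use set_parent_pmf[of T] in auto)
    also have "\<dots> = (\<Sum>u\<in>nodes T. weight \<beta> T u * h (T @ [u])) / W k"
      using support_grow[OF that]
      by (simp add: pmf_parent_pmf[OF beta] sum_weight sum_divide_distrib mult.commute)
    finally show ?thesis .
  qed
  have fin: "finite (set_pmf (map_pmf (\<lambda>u. T @ [u]) (parent_pmf \<beta> T)))" for T
    using finite_subset[OF set_parent_pmf] by simp
  have "mean_grow (Suc k) h = (\<Sum>T\<in>set_pmf (grow \<beta> k). pmf (grow \<beta> k) T *\<^sub>R
      measure_pmf.expectation (map_pmf (\<lambda>u. T @ [u]) (parent_pmf \<beta> T)) h)"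
    unfolding grow.simps by (rule pmf_expectation_bind) (use fin in auto)
  also have "\<dots> = (\<Sum>T\<in>set_pmf (grow \<beta> k).
      ((\<Sum>u\<in>nodes T. weight \<beta> T u * h (T @ [u])) / W k) * pmf (grow \<beta> k) T)"
    by (intro sum.cong) (simp_all add: inner del: integral_map_pmf)
  also have "\<dots> = mean_grow k (\<lambda>T. (\<Sum>u\<in>nodes T. weight \<beta> T u * h (T @ [u])) / W k)"
    by (rule integral_measure_pmf_real[symmetric]) auto
  finally show ?thesis .
qed

lemma mean_grow_Suc_le:
  assumes "\<And>T. recursive_tree T \<Longrightarrow> length T = k \<Longrightarrow>
    (\<Sum>u\<in>nodes T. weight \<beta> T u * h (T @ [u])) / W k \<le> g T"
  shows "mean_grow (Suc k) h \<le> mean_grow k g"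
  unfolding mean_grow_Suc by (rule mean_grow_mono) (use assms in auto)

lemma mean_grow_Suc_eq:
  assumes "\<And>T. recursive_tree T \<Longrightarrow> length T = k \<Longrightarrow>
    (\<Sum>u\<in>nodes T. weight \<beta> T u * h (T @ [u])) / W k = g T"
  shows "mean_grow (Suc k) h = mean_grow k g"
  unfolding mean_grow_Suc by (rule mean_grow_cong) (use assms in auto)

section \<open>The mean and the martingale\<close>

text \<open>Here \<open>k\<close> counts insertions, so that the tree has \<open>k + 1\<close> nodes.\<close>

definition mean_length :: "nat \<Rightarrow> real" where
  "mean_length k = mean_grow k (\<lambda>T. real (internal_path_length T))"

text \<open>Dividing by the total weight makes the linear recursion for the mean telescope, so the mean is
  an explicit sum of terms of order \<open>1 / (c\<^sup>2 k)\<close>.\<close>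

lemma mean_length_Suc:
  "mean_length (Suc k) / W (Suc k) = mean_length k / W k + (real k + 1) / (W k * W (Suc k))"
proof -
  have "mean_length (Suc k) =
      mean_grow k (\<lambda>T. (W (Suc k) / W k) * real (internal_path_length T) + (1 - \<beta> * real k / W k))"
    unfolding mean_length_def
  proof (rule mean_grow_Suc_eq)
    fix T :: inc_tree assume T: "recursive_tree T" "length T = k"
    have "(\<Sum>u\<in>nodes T. weight \<beta> T u * real (internal_path_length (T @ [u]))) =
      (\<Sum>u\<in>nodes T. weight \<beta> T u * (real (internal_path_length T) + 1) + weight \<beta> T u * real (depth T u))"
      using T by (intro sum.cong) (auto simp: path_length_append recursive_tree_append algebra_simps)
    also have "\<dots> = W k * (real (internal_path_length T) + 1) + weighted_sum \<beta> real T"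
      using T by (simp add: sum.distrib sum_weight flip: sum_distrib_right) (simp add: weighted_sum_def)
    finally have eq: "(\<Sum>u\<in>nodes T. weight \<beta> T u * real (internal_path_length (T @ [u]))) =
      W k * (real (internal_path_length T) + 1) + weighted_sum \<beta> real T" .
    show "(\<Sum>u\<in>nodes T. weight \<beta> T u * real (internal_path_length (T @ [u]))) / W k =
      (W (Suc k) / W k) * real (internal_path_length T) + (1 - \<beta> * real k / W k)"
      unfolding eq using T total_weight_pos[of k]
      by (simp add: weighted_sum_depth total_weight_Suc field_simps)
  qed
  also have "\<dots> = (W (Suc k) / W k) * mean_length k + (1 - \<beta> * real k / W k)"
    by (simp add: mean_length_def)
  also have "\<dots> = W (Suc k) * (mean_length k / W k + (W k - \<beta> * real k) / (W k * W (Suc k)))"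
    using total_weight_pos[of k] total_weight_pos[of "Suc k"] by (simp add: field_simps)
  finally have "mean_length (Suc k) / W (Suc k) =
      mean_length k / W k + (W k - \<beta> * real k) / (W k * W (Suc k))"
    using total_weight_pos[of "Suc k"] by simp
  also have "W k - \<beta> * real k = real k + 1" by (simp add: total_weight_def algebra_simps)
  finally show ?thesis .
qed

lemma mean_length_0: "mean_length 0 = 0"
  by (simp add: mean_length_def path_length_Nil)

lemma mean_length_upper: "mean_length k / W k \<le> ln (real k + 1)"
proof (induction k)
  case (Suc k)
  have "(real k + 1) / (W k * W (Suc k)) \<le> (real k + 1) / ((real k + 1) * (real k + 2))"
    using total_weight_ge[of k] total_weight_ge[of "Suc k"]
    by (intro divide_left_mono mult_mono mult_pos_pos) auto
  also have "\<dots> = 1 / (real k + 2)" by simp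
  also have "\<dots> \<le> ln (real k + 2) - ln (real k + 1)"
    by (rule inverse_le_ln_diff)
  finally have "mean_length (Suc k) / W (Suc k) \<le> ln (real k + 2)"
    using Suc unfolding mean_length_Suc by linarith
  then show ?case by (simp add: add.commute)
qed (simp add: mean_length_0)

lemma mean_length_lower: "mean_length k / W k \<ge> ln ((real k + 2) / 2) / (1 + \<beta>)\<^sup>2"
proof (induction k)
  case (Suc k)
  let ?c = "1 + \<beta>"
  have c: "?c > 0" using beta by simp
  have "W k * W (Suc k) \<le> (?c * (real k + 1)) * (?c * (real k + 2))"
    using total_weight_le[of k] total_weight_le[of "Suc k"] total_weight_pos[of "Suc k"] c
    by (intro mult_mono) (auto simp: less_imp_le add.commute)
  then have "(real k + 1) / ((?c * (real k + 1)) * (?c * (real k + 2))) \<le> (real k + 1) / (W k * W (Suc k))"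
    using total_weight_pos c by (intro divide_left_mono mult_pos_pos) auto
  moreover have "(real k + 1) / ((?c * (real k + 1)) * (?c * (real k + 2))) = (1 / (real k + 2)) / ?c\<^sup>2"
    using c by (simp add: power2_eq_square divide_simps)
  moreover have "ln ((real k + 3) / 2) - ln ((real k + 2) / 2) \<le> 1 / (real k + 2)"
  proof -
    have "ln ((real k + 3) / (real k + 2)) \<le> (real k + 3) / (real k + 2) - 1"
      by (intro ln_le_minus_one) auto
    then show ?thesis by (simp add: ln_div field_simps)
  qed
  then have "(ln ((real k + 3) / 2) - ln ((real k + 2) / 2)) / ?c\<^sup>2 \<le> (1 / (real k + 2)) / ?c\<^sup>2"
    by (intro divide_right_mono) auto
  ultimately have "ln ((real k + 3) / 2) / ?c\<^sup>2 \<le> mean_length (Suc k) / W (Suc k)"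
    using Suc unfolding mean_length_Suc diff_divide_distrib by linarith
  then show ?case by (simp add: add.commute)
qed (simp add: mean_length_0)

text \<open>This is the martingale \<open>M\<close>.\<close>

definition deviation :: "inc_tree \<Rightarrow> real" where
  "deviation T = (real (internal_path_length T) - mean_length (length T)) / W (length T)"

definition mean_parent_depth :: "inc_tree \<Rightarrow> real" where
  "mean_parent_depth T = weighted_sum \<beta> real T / W (length T)"

lemma deviation_append:
  assumes "recursive_tree (T @ [u])"
  shows "deviation (T @ [u]) =
    deviation T + (real (depth T u) - mean_parent_depth T) / W (Suc (length T))"
proof -
  let ?k = "length T"
  have pos: "W ?k > 0" "W (Suc ?k) > 0" by (rule total_weight_pos)+
  have T: "recursive_tree T" using assms by (simp add: recursive_tree_append)
  have "mean_length (Suc ?k) = W (Suc ?k) / W ?k * mean_length ?k + (real ?k + 1) / W ?k"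
    using mean_length_Suc[of ?k] pos by (simp add: field_simps)
  then have "real (internal_path_length (T @ [u])) - mean_length (Suc ?k) =
    W (Suc ?k) / W ?k * (real (internal_path_length T) - mean_length ?k)
    + (real (depth T u) - mean_parent_depth T)"
    using pos T assms
    by (simp add: path_length_append mean_parent_depth_def weighted_sum_depth
        total_weight_Suc divide_simps) (simp add: total_weight_def algebra_simps)
  then show ?thesis
    using pos unfolding deviation_def by (simp add: add_divide_distrib)
qed

lemma sum_weight_centred:
  assumes "recursive_tree T"
  shows "(\<Sum>u\<in>nodes T. weight \<beta> T u * (real (depth T u) - mean_parent_depth T)) = 0"
proof -
  have "(\<Sum>u\<in>nodes T. weight \<beta> T u * (real (depth T u) - mean_parent_depth T)) =
    weighted_sum \<beta> real T - W (length T) * mean_parent_depth T"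
    by (simp add: right_diff_distrib sum_subtractf sum_weight[OF assms] flip: sum_distrib_right)
       (simp add: weighted_sum_def)
  then show ?thesis
    using total_weight_pos[of "length T"] by (simp add: mean_parent_depth_def)
qed

lemma mean_deviation: "mean_grow k deviation = 0"
proof -
  have "mean_grow k deviation = mean_grow k (\<lambda>T. (real (internal_path_length T) - mean_length k) / W k)"
    by (rule mean_grow_cong) (auto simp: deviation_def)
  then show ?thesis by (simp add: mean_length_def)
qed


section \<open>Deep nodes\<close>

text \<open>Markov's inequality in the form that all tail estimates use.\<close>

lemma prob_le_mean:
  assumes "\<And>T. recursive_tree T \<Longrightarrow> length T = k \<Longrightarrow> 0 \<le> f T"
    and "\<And>T. recursive_tree T \<Longrightarrow> length T = k \<Longrightarrow> T \<in> A \<Longrightarrow> 1 \<le> f T"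
  shows "prob_grow k A \<le> mean_grow k f"
  unfolding prob_eq_mean
  by (rule mean_grow_mono) (use assms in \<open>auto split: split_indicator\<close>)

lemma weighted_sum_nonneg: "(\<And>d. 0 \<le> g d) \<Longrightarrow> 0 \<le> weighted_sum \<beta> g T"
  using weight_ge_1[of T] unfolding weighted_sum_def
  by (intro sum_nonneg mult_nonneg_nonneg) (auto intro: order_trans[OF zero_le_one])

text \<open>The sum is multiplied in expectation by \<open>(W k + \<beta> + exp z) / W k\<close>, whereas \<open>W\<close> itself grows by
  the factor \<open>(W k + \<beta> + 1) / W k\<close>. The excess \<open>1 + (exp z - 1) / W (k + 1)\<close> has a product of
  order \<open>k powr (exp z - 1)\<close>, as \<open>W (k + 1) \<ge> k + 2\<close>.\<close>

lemma exponential_depth_moment: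
  assumes "z \<ge> 0"
  shows "mean_grow k (weighted_sum \<beta> (\<lambda>d. exp (z * real d))) \<le> W k * (real k + 1) powr (exp z - 1)"
proof (induction k)
  case (Suc k)
  let ?Y = "weighted_sum \<beta> (\<lambda>d. exp (z * real d))" and ?r = "exp z - 1"
  have r: "?r \<ge> 0" using assms by simp
  have pos: "W k > 0" "W (Suc k) > 0" by (rule total_weight_pos)+
  have "mean_grow (Suc k) ?Y = mean_grow k (\<lambda>T. (W k + \<beta> + exp z) / W k * ?Y T)"
  proof (rule mean_grow_Suc_eq)
    fix T :: inc_tree assume T: "recursive_tree T" "length T = k"
    have "(\<Sum>u\<in>nodes T. weight \<beta> T u * ?Y (T @ [u])) =
      (\<Sum>u\<in>nodes T. weight \<beta> T u * ?Y T + (\<beta> + exp z) * (weight \<beta> T u * exp (z * real (depth T u))))"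
      using T by (intro sum.cong)
        (auto simp: weighted_sum_append recursive_tree_append algebra_simps simp flip: exp_add)
    also have "\<dots> = W k * ?Y T + (\<beta> + exp z) * ?Y T"
      using T by (simp add: sum.distrib sum_weight flip: sum_distrib_right sum_distrib_left)
         (simp add: weighted_sum_def)
    finally have eq: "(\<Sum>u\<in>nodes T. weight \<beta> T u * ?Y (T @ [u])) = W k * ?Y T + (\<beta> + exp z) * ?Y T" .
    show "(\<Sum>u\<in>nodes T. weight \<beta> T u * ?Y (T @ [u])) / W k = (W k + \<beta> + exp z) / W k * ?Y T"
      unfolding eq by (simp add: algebra_simps)
  qed
  also have "\<dots> = (W k + \<beta> + exp z) / W k * mean_grow k ?Y" by simp
  also have "\<dots> \<le> (W k + \<beta> + exp z) / W k * (W k * (real k + 1) powr ?r)"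
    using Suc pos beta by (intro mult_left_mono) auto
  also have "\<dots> = W (Suc k) * ((real k + 1) powr ?r * (1 + ?r / W (Suc k)))"
    using pos by (simp add: total_weight_Suc field_simps)
  also have "\<dots> \<le> W (Suc k) * ((real k + 1) powr ?r * ((real k + 2) / (real k + 1)) powr ?r)"
  proof (intro mult_left_mono)
    have "?r / W (Suc k) \<le> ?r * (1 / (real k + 2))"
      using r total_weight_ge[of "Suc k"] by (auto intro!: divide_left_mono mult_pos_pos pos)
    also have "\<dots> \<le> ?r * ln ((real k + 2) / (real k + 1))"
      using inverse_le_ln_diff[of k] r by (intro mult_left_mono) (auto simp: ln_div)
    also have "1 + \<dots> \<le> exp (?r * ln ((real k + 2) / (real k + 1)))"
      by (rule exp_ge_add_one_self)
    finally show "1 + ?r / W (Suc k) \<le> ((real k + 2) / (real k + 1)) powr ?r"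
      by (simp add: powr_def add_eq_0_iff)
  qed (use pos in auto)
  also have "(real k + 1) powr ?r * ((real k + 2) / (real k + 1)) powr ?r = (real k + 2) powr ?r"
    by (simp flip: powr_mult)
  finally show ?case by (simp add: add.commute)
qed (simp add: weighted_sum_Nil total_weight_def)

text \<open>One node of depth \<open>h\<close> contributes at least \<open>exp (z h)\<close> to the exponential depth sum, so
  Markov's inequality applies with a free parameter \<open>z\<close>.\<close>

lemma prob_deep_node:
  assumes "z \<ge> 0"
  shows "prob_grow k {T. \<exists>u\<in>nodes T. h \<le> real (depth T u)}
    \<le> exp (- z * h) * (W k * (real k + 1) powr (exp z - 1))"
proof -
  let ?Y = "weighted_sum \<beta> (\<lambda>d. exp (z * real d))"
  have "prob_grow k {T. \<exists>u\<in>nodes T. h \<le> real (depth T u)} \<le> mean_grow k (\<lambda>T. exp (- z * h) * ?Y T)"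
  proof (rule prob_le_mean)
    fix T assume "T \<in> {T. \<exists>u\<in>nodes T. h \<le> real (depth T u)}"
    then obtain u where u: "u \<in> nodes T" "h \<le> real (depth T u)" by auto
    have "exp (z * h) \<le> 1 * exp (z * real (depth T u))" using u assms by (simp add: mult_left_mono)
    also have "\<dots> \<le> weight \<beta> T u * exp (z * real (depth T u))"
      using weight_ge_1 by (intro mult_right_mono) auto
    also have "\<dots> \<le> ?Y T"
      unfolding weighted_sum_def
    proof (rule member_le_sum)
      show "0 \<le> weight \<beta> T x * exp (z * real (depth T x))" for x
        using weight_ge_1[of T x] by simp
    qed (use u in auto)
    finally show "1 \<le> exp (- z * h) * ?Y T" by (simp add: exp_minus field_simps)
  qed (auto intro!: mult_nonneg_nonneg weighted_sum_nonneg)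
  also have "\<dots> = exp (- z * h) * mean_grow k ?Y" by simp
  also have "\<dots> \<le> exp (- z * h) * (W k * (real k + 1) powr (exp z - 1))"
    using exponential_depth_moment[OF assms] by (intro mult_left_mono) auto
  finally show ?thesis .
qed

section \<open>The variance\<close>

text \<open>By orthogonality of martingale increments, the second moment grows in a step by at most the
  mean squared depth of the parent over \<open>W (k + 1)\<^sup>2\<close>. Bounding \<open>d\<^sup>2 \<le> 8 exp (d / 2)\<close>, this is of
  order \<open>k powr (exp (1 / 2) - 3)\<close>, and it is summable because \<open>exp (1 / 2) < 2\<close>.\<close>

lemma variance_bound: "\<exists>S>0. \<forall>k. mean_grow k (\<lambda>T. (deviation T)\<^sup>2) \<le> S"
proof -
  define e where "e = (\<lambda>j. 8 * (real j + 1) powr (- 5 / 4))"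
  have summ: "summable e"
  proof -
    have "summable (\<lambda>n. real n powr (- 5 / 4))" by (subst summable_real_powr_iff) auto
    then have "summable (\<lambda>n. real (Suc n) powr (- 5 / 4))" by (subst summable_Suc_iff)
    then show ?thesis unfolding e_def by (intro summable_mult) (simp add: add.commute)
  qed
  \<comment> \<open>turns the exponent \<open>exp (1 / 2) - 1\<close> into the rational \<open>3 / 4\<close>\<close>
  have half: "exp (1 / 2 :: real) \<le> 7 / 4"
  proof (rule power2_le_imp_le)
    have "(exp (1 / 2 :: real))\<^sup>2 = exp 1" by (simp flip: exp_double)
    then show "(exp (1 / 2 :: real))\<^sup>2 \<le> (7 / 4)\<^sup>2"
      using e_less_272 by (simp add: power2_eq_square)
  qed auto
  have step: "mean_grow (Suc k) (\<lambda>T. (deviation T)\<^sup>2) \<le> mean_grow k (\<lambda>T. (deviation T)\<^sup>2) + e k" for k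
  proof -
    let ?Y = "weighted_sum \<beta> (\<lambda>d. exp (1 / 2 * real d))"
    have pos: "W k > 0" "W (Suc k) > 0" by (rule total_weight_pos)+
    have "mean_grow (Suc k) (\<lambda>T. (deviation T)\<^sup>2) \<le>
      mean_grow k (\<lambda>T. (deviation T)\<^sup>2 + 8 / (W k * (W (Suc k))\<^sup>2) * ?Y T)"
    proof (rule mean_grow_Suc_le)
      fix T :: inc_tree assume T: "recursive_tree T" "length T = k"
      let ?m = "mean_parent_depth T" and ?w = "weight \<beta> T" and ?x = "deviation T"
      let ?d = "\<lambda>u. real (depth T u)"
      have "(\<Sum>u\<in>nodes T. ?w u * (deviation (T @ [u]))\<^sup>2) =
        (\<Sum>u\<in>nodes T. ?w u * ?x\<^sup>2 + 2 * ?x / W (Suc k) * (?w u * (?d u - ?m))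
             + ?w u * (?d u - ?m)\<^sup>2 / (W (Suc k))\<^sup>2)"
      proof (rule sum.cong)
        fix u assume "u \<in> nodes T"
        then have "deviation (T @ [u]) = ?x + (?d u - ?m) / W (Suc k)"
          using T by (simp add: deviation_append recursive_tree_append)
        then have "(deviation (T @ [u]))\<^sup>2 =
            ?x\<^sup>2 + 2 * ?x / W (Suc k) * (?d u - ?m) + (?d u - ?m)\<^sup>2 / (W (Suc k))\<^sup>2"
          by (simp only: power2_sum power_divide) simp
        then show "?w u * (deviation (T @ [u]))\<^sup>2 =
          ?w u * ?x\<^sup>2 + 2 * ?x / W (Suc k) * (?w u * (?d u - ?m))
             + ?w u * (?d u - ?m)\<^sup>2 / (W (Suc k))\<^sup>2"
          by (simp only: distrib_left) (simp only: times_divide_eq_right mult_ac)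
      qed simp
      also have "\<dots> = W k * ?x\<^sup>2 + (\<Sum>u\<in>nodes T. ?w u * (?d u - ?m)\<^sup>2) / (W (Suc k))\<^sup>2"
      proof -
        have "(\<Sum>u\<in>nodes T. 2 * ?x / W (Suc k) * (?w u * (?d u - ?m))) = 0"
          by (simp only: sum_distrib_left [symmetric] sum_weight_centred[OF T(1)] mult_zero_right)
        then show ?thesis
          using T by (simp only: sum.distrib sum_divide_distrib sum_distrib_right [symmetric]
              sum_weight add_0_right)
      qed
      also have "(\<Sum>u\<in>nodes T. ?w u * (?d u - ?m)\<^sup>2) \<le> 8 * ?Y T"
      proof -
        \<comment> \<open>the second moment about the mean is at most the raw second moment\<close>
        have "(\<Sum>u\<in>nodes T. ?w u * (?d u - ?m)\<^sup>2) =
          (\<Sum>u\<in>nodes T. ?w u * (?d u)\<^sup>2 - 2 * ?m * (?w u * (?d u - ?m)) - ?w u * ?m\<^sup>2)"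
          by (intro sum.cong refl) (simp add: power2_eq_square algebra_simps)
        also have "\<dots> = (\<Sum>u\<in>nodes T. ?w u * (?d u)\<^sup>2) - W k * ?m\<^sup>2"
          using T by (simp add: sum_subtractf sum_weight sum_weight_centred
              flip: sum_distrib_right sum_distrib_left)
        also have "\<dots> \<le> (\<Sum>u\<in>nodes T. ?w u * (?d u)\<^sup>2)" using pos by simp
        also have "\<dots> \<le> (\<Sum>u\<in>nodes T. ?w u * (8 * exp (1 / 2 * ?d u)))"
        proof (intro sum_mono mult_left_mono)
          fix u
          show "(?d u)\<^sup>2 \<le> 8 * exp (1 / 2 * ?d u)"
            using exp_lower_Taylor_quadratic[of "?d u / 2"] by (simp add: power_divide)
          show "0 \<le> ?w u" using weight_ge_1[of T u] by simp
        qed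
        also have "\<dots> = 8 * ?Y T" by (simp add: weighted_sum_def sum_distrib_left mult_ac)
        finally show ?thesis .
      qed
      finally have "(\<Sum>u\<in>nodes T. ?w u * (deviation (T @ [u]))\<^sup>2) \<le>
          W k * ?x\<^sup>2 + 8 * ?Y T / (W (Suc k))\<^sup>2"
        using pos by (simp add: divide_right_mono)
      then have "(\<Sum>u\<in>nodes T. ?w u * (deviation (T @ [u]))\<^sup>2) / W k \<le>
          (W k * ?x\<^sup>2 + 8 * ?Y T / (W (Suc k))\<^sup>2) / W k"
        using pos by (intro divide_right_mono) auto
      also have "\<dots> = ?x\<^sup>2 + 8 / (W k * (W (Suc k))\<^sup>2) * ?Y T"
        using pos by (simp add: field_simps)
      finally show "(\<Sum>u\<in>nodes T. ?w u * (deviation (T @ [u]))\<^sup>2) / W k \<le>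
        ?x\<^sup>2 + 8 / (W k * (W (Suc k))\<^sup>2) * ?Y T" .
    qed
    also have "\<dots> = mean_grow k (\<lambda>T. (deviation T)\<^sup>2) + 8 / (W k * (W (Suc k))\<^sup>2) * mean_grow k ?Y"
      by simp
    also have "8 / (W k * (W (Suc k))\<^sup>2) * mean_grow k ?Y \<le>
        8 / (W k * (W (Suc k))\<^sup>2) * (W k * (real k + 1) powr (exp (1 / 2) - 1))"
      using exponential_depth_moment[of "1 / 2" k] pos by (intro mult_left_mono) auto
    also have "\<dots> = 8 * (real k + 1) powr (exp (1 / 2) - 1) / (W (Suc k))\<^sup>2"
      using pos by (simp add: field_simps)
    also have "\<dots> \<le> 8 * (real k + 1) powr (3 / 4) / (real k + 1)\<^sup>2"
      using half total_weight_ge[of "Suc k"]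
      by (intro frac_le mult_left_mono powr_mono power_mono) auto
    also have "\<dots> = e k"
    proof -
      have "(real k + 1)\<^sup>2 = (real k + 1) powr 2" by (simp add: powr_numeral)
      moreover have "(real k + 1) powr (3 / 4) / (real k + 1) powr 2 = (real k + 1) powr (3 / 4 - 2)"
        by (rule powr_diff [symmetric])
      ultimately show ?thesis by (simp only: e_def times_divide_eq_right [symmetric]) simp
    qed
    finally show ?thesis by simp
  qed
  have "mean_grow k (\<lambda>T. (deviation T)\<^sup>2) \<le> (\<Sum>j<k. e j)" for k
  proof (induction k)
    case 0
    then show ?case by (simp add: deviation_def path_length_Nil mean_length_0)
  next
    case (Suc k)
    then show ?case using step[of k] by simp
  qed
  also have "(\<Sum>j<k. e j) \<le> suminf e" for k
    by (rule sum_le_suminf[OF summ]) (auto simp: e_def)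
  finally have bound: "mean_grow k (\<lambda>T. (deviation T)\<^sup>2) \<le> suminf e" for k .
  have "mean_grow k (\<lambda>T. (deviation T)\<^sup>2) \<le> \<bar>suminf e\<bar> + 1" for k
    using bound[of k] by linarith
  then show ?thesis by (intro exI[of _ "\<bar>suminf e\<bar> + 1"]) auto
qed


text \<open>Markov's inequality for \<open>(X + v / t)\<^sup>2\<close>, the shift being the optimal one. The value stays below
  \<open>1\<close> for every \<open>t > 0\<close>, as it must for comparison with a Gaussian near \<open>t = 0\<close>.\<close>

lemma one_sided_chebyshev:
  assumes "mean_grow k X = 0" "mean_grow k (\<lambda>T. (X T)\<^sup>2) \<le> v" "v > 0" "t > 0"
  shows "prob_grow k {T. t < X T} \<le> v / (v + t\<^sup>2)"
proof -
  define a where "a = v / t"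
  have a: "a > 0" using assms by (simp add: a_def)
  have "prob_grow k {T. t < X T} \<le> mean_grow k (\<lambda>T. ((X T + a) / (t + a))\<^sup>2)"
  proof (rule prob_le_mean)
    fix T assume "T \<in> {T. t < X T}"
    then have "1 \<le> (X T + a) / (t + a)" using a assms by simp
    then show "1 \<le> ((X T + a) / (t + a))\<^sup>2" by (rule one_le_power)
  qed auto
  also have "\<dots> = mean_grow k (\<lambda>T. ((X T)\<^sup>2 + 2 * a * X T + a\<^sup>2) / (t + a)\<^sup>2)"
    by (simp add: power_divide power2_sum mult_ac add_ac)
  also have "\<dots> = (mean_grow k (\<lambda>T. (X T)\<^sup>2) + a\<^sup>2) / (t + a)\<^sup>2"
    using assms(1) by simp
  also have "\<dots> \<le> (v + a\<^sup>2) / (t + a)\<^sup>2"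
    using assms(2) by (intro divide_right_mono) auto
  also have "\<dots> = v / (v + t\<^sup>2)"
  proof -
    have "v + a\<^sup>2 = v * (v + t\<^sup>2) / t\<^sup>2" "(t + a)\<^sup>2 = (v + t\<^sup>2)\<^sup>2 / t\<^sup>2"
      using assms by (auto simp: a_def field_simps power2_eq_square)
    then show ?thesis using assms by (simp add: power2_eq_square add_pos_pos)
  qed
  finally show ?thesis .
qed

section \<open>Exponential moments as long as the tree is shallow\<close>

text \<open>All depths are below the fourth root of the size. Large trees violate this with a stretched
  exponentially small probability, and on shallow trees an insertion moves the martingale by at
  most \<open>(k + 1) powr (- 3 / 4)\<close>, which is square summable.\<close>

definition shallow :: "inc_tree \<Rightarrow> bool" where
  "shallow T \<longleftrightarrow> (\<forall>u\<in>nodes T. (1 + depth T u) ^ 4 \<le> length T + 1)"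

lemma weighted_mean_le:
  assumes "recursive_tree T" "length T = k" "\<And>u. u \<in> nodes T \<Longrightarrow> f u \<le> a"
  shows "(\<Sum>u\<in>nodes T. weight \<beta> T u * f u) / W k \<le> a"
proof -
  have "(\<Sum>u\<in>nodes T. weight \<beta> T u * f u) \<le> (\<Sum>u\<in>nodes T. weight \<beta> T u * a)"
    using assms weight_ge_1[of T] by (intro sum_mono mult_left_mono) (auto intro: order_trans[OF zero_le_one])
  also have "\<dots> = W k * a" using assms sum_weight by (simp flip: sum_distrib_right)
  finally show ?thesis using total_weight_pos[of k] by (simp add: field_simps)
qed

text \<open>The martingale increment times \<open>\<theta>\<close>, called \<open>y\<close>, has mean zero and absolute value at most \<open>1\<close>, so that
  \<open>exp y \<le> 1 + y + y\<^sup>2\<close> leaves only the quadratic term.\<close>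

lemma shallow_exp_step:
  assumes T: "recursive_tree T" "length T = k" and sh: "shallow T" and lam: "\<theta>\<^sup>2 \<le> real k + 1"
  shows "(\<Sum>u\<in>nodes T. weight \<beta> T u * exp (\<theta> * deviation (T @ [u]))) / W k
    \<le> exp (\<theta>\<^sup>2 * (real k + 1) powr (- 3 / 2)) * exp (\<theta> * deviation T)"
proof -
  let ?m = "mean_parent_depth T"
  define q where "q = (real k + 1) powr (1 / 4)"
  define a where "a = \<theta>\<^sup>2 * (real k + 1) powr (- 3 / 2)"
  define y where "y = (\<lambda>u. \<theta> / W (Suc k) * (real (depth T u) - ?m))"
  have pos: "W k > 0" "W (Suc k) > 0" by (rule total_weight_pos)+
  have d: "real (depth T u) \<le> q" if "u \<in> nodes T" for u
  proof -
    have "depth T u ^ 4 \<le> (1 + depth T u) ^ 4" by (intro power_mono) auto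
    also have "\<dots> \<le> k + 1" using sh that T by (auto simp: shallow_def)
    finally have "real (depth T u ^ 4) \<le> real (k + 1)" by (simp only: of_nat_le_iff)
    then have "real (depth T u) ^ 4 \<le> real k + 1" by simp
    also have "real k + 1 = q ^ 4" by (simp add: q_def powr_power)
    finally show ?thesis
      by (rule power_mono_iff[THEN iffD1, rotated 3]) (auto simp: q_def)
  qed
  have m: "?m \<le> q" "0 \<le> ?m"
    using weighted_mean_le[OF T d] T pos weighted_sum_nonneg[of real T]
    by (auto simp: mean_parent_depth_def weighted_sum_def)
  have q2: "q\<^sup>2 = (real k + 1) powr (1 / 2)" by (simp add: q_def powr_power)
  have y2: "(y u)\<^sup>2 \<le> a" if "u \<in> nodes T" for u
  proof -
    have "\<bar>real (depth T u) - ?m\<bar> \<le> \<bar>q\<bar>" using d[OF that] m by auto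
    then have "(real (depth T u) - ?m)\<^sup>2 \<le> q\<^sup>2" by (simp add: abs_le_square_iff)
    then have "(y u)\<^sup>2 \<le> \<theta>\<^sup>2 / (W (Suc k))\<^sup>2 * q\<^sup>2"
      unfolding y_def by (simp add: power_mult_distrib power_divide mult_left_mono divide_right_mono)
    also have "\<dots> \<le> \<theta>\<^sup>2 / (real k + 1)\<^sup>2 * q\<^sup>2"
      using total_weight_ge[of "Suc k"] by (intro mult_right_mono divide_left_mono power_mono mult_pos_pos) auto
    also have "\<dots> = \<theta>\<^sup>2 * ((real k + 1) powr (1 / 2) / (real k + 1) powr 2)"
      by (simp add: q2 powr_numeral)
    also have "(real k + 1) powr (1 / 2) / (real k + 1) powr 2 = (real k + 1) powr (1 / 2 - 2)"
      by (rule powr_diff [symmetric])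
    also have "\<theta>\<^sup>2 * (real k + 1) powr (1 / 2 - 2) = a" by (simp add: a_def)
    finally show ?thesis .
  qed
  have "a \<le> (real k + 1) powr 1 * (real k + 1) powr (- 3 / 2)"
    using lam by (simp add: a_def mult_right_mono)
  also have "\<dots> = (real k + 1) powr (1 + (- 3 / 2))" by (rule powr_add [symmetric])
  also have "\<dots> \<le> (real k + 1) powr 0" by (intro powr_mono) auto
  finally have a1: "a \<le> 1" by simp
  have e: "exp (y u) \<le> 1 + y u + a" if "u \<in> nodes T" for u
  proof -
    have "(y u)\<^sup>2 \<le> 1\<^sup>2" using y2[OF that] a1 by simp
    then have "\<bar>y u\<bar> \<le> 1" by (simp only: power2_le_iff_abs_le zero_le_one)
    then show ?thesis using exp_le_quadratic[of "y u"] y2[OF that] by linarith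
  qed
  have "(\<Sum>u\<in>nodes T. weight \<beta> T u * exp (\<theta> * deviation (T @ [u]))) =
    (\<Sum>u\<in>nodes T. exp (\<theta> * deviation T) * (weight \<beta> T u * exp (y u)))"
    using T by (intro sum.cong refl)
      (simp add: deviation_append recursive_tree_append y_def distrib_left exp_add)
  also have "\<dots> = exp (\<theta> * deviation T) * (\<Sum>u\<in>nodes T. weight \<beta> T u * exp (y u))"
    by (simp add: sum_distrib_left)
  also have "(\<Sum>u\<in>nodes T. weight \<beta> T u * exp (y u)) \<le> (\<Sum>u\<in>nodes T. weight \<beta> T u * (1 + y u + a))"
    using e weight_ge_1[of T] by (intro sum_mono mult_left_mono) (auto intro: order_trans[OF zero_le_one])
  also have "\<dots> = (\<Sum>u\<in>nodes T. weight \<beta> T u * (1 + a) + 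
      \<theta> / W (Suc k) * (weight \<beta> T u * (real (depth T u) - ?m)))"
    by (simp add: y_def algebra_simps)
  also have "\<dots> = W k * (1 + a)"
    using T(2) by (simp only: sum.distrib sum_distrib_right [symmetric] sum_distrib_left [symmetric]
        sum_weight[OF T(1)] sum_weight_centred[OF T(1)] mult_zero_right add_0_right)
  also have "\<dots> \<le> W k * exp a" using pos by (intro mult_left_mono exp_ge_add_one_self) auto
  finally have "(\<Sum>u\<in>nodes T. weight \<beta> T u * exp (\<theta> * deviation (T @ [u]))) \<le>
    exp (\<theta> * deviation T) * (W k * exp a)" by simp
  then show ?thesis using pos by (simp add: field_simps a_def)
qed

text \<open>The event restricts the history of the tree, which is recoverable because \<open>take j T\<close> is the
  tree after \<open>j\<close> insertions. Only the trees before the last insertion are required to be shallow;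
  this makes the event at time \<open>k + 1\<close> depend on the tree at time \<open>k\<close> alone, so that the step lemma
  applies to each remaining tree.\<close>

lemma shallow_exp_moment:
  fixes Q :: "inc_tree \<Rightarrow> bool"
  assumes "j0 \<le> k" and lam: "\<theta>\<^sup>2 \<le> real j0 + 1"
  shows "mean_grow k (\<lambda>T. if Q (take j0 T) \<and> (\<forall>j\<in>{j0..<k}. shallow (take j T))
      then exp (\<theta> * deviation T) else 0)
    \<le> exp (\<theta>\<^sup>2 * (\<Sum>j=j0..<k. (real j + 1) powr (- 3 / 2)))
      * mean_grow j0 (\<lambda>T. if Q T then exp (\<theta> * deviation T) else 0)"
  using assms(1)
proof (induction k rule: dec_induct)
  case base
  have "mean_grow j0 (\<lambda>T. if Q (take j0 T) \<and> (\<forall>j\<in>{j0..<j0}. shallow (take j T))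
      then exp (\<theta> * deviation T) else 0) = mean_grow j0 (\<lambda>T. if Q T then exp (\<theta> * deviation T) else 0)"
    by (rule mean_grow_cong) auto
  then show ?case by simp
next
  case (step k)
  define G where "G = (\<lambda>k T. Q (take j0 T) \<and> (\<forall>j\<in>{j0..<k}. shallow (take j T)))"
  let ?F = "\<lambda>k T. if G k T then exp (\<theta> * deviation T) else 0"
  let ?a = "\<lambda>k. \<theta>\<^sup>2 * (real k + 1) powr (- 3 / 2)"
  have "mean_grow (Suc k) (?F (Suc k)) \<le> mean_grow k (\<lambda>T. exp (?a k) * ?F k T)"
  proof (rule mean_grow_Suc_le)
    fix T :: inc_tree assume T: "recursive_tree T" "length T = k"
    have G: "G (Suc k) (T @ [u]) \<longleftrightarrow> G k T \<and> shallow T" for u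
    proof -
      have "take j (T @ [u]) = take j T" if "j \<le> k" for j using T that by simp
      moreover have "{j0..<Suc k} = insert k {j0..<k}" using step by auto
      ultimately show ?thesis using T step by (auto simp: G_def)
    qed
    show "(\<Sum>u\<in>nodes T. weight \<beta> T u * ?F (Suc k) (T @ [u])) / W k \<le> exp (?a k) * ?F k T"
    proof (cases "G k T \<and> shallow T")
      case True
      then show ?thesis
        using shallow_exp_step[OF T, of \<theta>] lam step by (simp add: G)
    qed (auto simp: G)
  qed
  also have "\<dots> = exp (?a k) * mean_grow k (?F k)" by simp
  also have "\<dots> \<le> exp (?a k) * (exp (\<theta>\<^sup>2 * (\<Sum>j=j0..<k. (real j + 1) powr (- 3 / 2)))
      * mean_grow j0 (\<lambda>T. if Q T then exp (\<theta> * deviation T) else 0))"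
    using step.IH unfolding G_def by (intro mult_left_mono) auto
  finally show ?case
    using step by (simp add: G_def distrib_left exp_add mult_ac)
qed

text \<open>A union bound over the first violation, phrased by the same recursion so that the laws of the
  prefixes never have to be identified.\<close>

lemma prob_not_shallow_prefix:
  fixes Q :: "inc_tree \<Rightarrow> bool"
  assumes "j0 \<le> k"
  shows "prob_grow k {T. \<not> (Q (take j0 T) \<and> (\<forall>j\<in>{j0..<k}. shallow (take j T)))}
    \<le> prob_grow j0 {T. \<not> Q T} + (\<Sum>j=j0..<k. prob_grow j {T. \<not> shallow T})"
  using assms
proof (induction k rule: dec_induct)
  case base
  have "prob_grow j0 {T. \<not> (Q (take j0 T) \<and> (\<forall>j\<in>{j0..<j0}. shallow (take j T)))} = prob_grow j0 {T. \<not> Q T}"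
    unfolding prob_eq_mean by (rule mean_grow_cong) (auto split: split_indicator)
  then show ?case by simp
next
  case (step k)
  define B where "B = (\<lambda>k. {T. \<not> (Q (take j0 T) \<and> (\<forall>j\<in>{j0..<k}. shallow (take j T)))})"
  let ?N = "{T. \<not> shallow T}"
  have "prob_grow (Suc k) (B (Suc k)) \<le> mean_grow k (\<lambda>T. indicator (B k) T + indicator ?N T)"
    unfolding prob_eq_mean
  proof (rule mean_grow_Suc_le)
    fix T :: inc_tree assume T: "recursive_tree T" "length T = k"
    have "T @ [u] \<in> B (Suc k) \<longleftrightarrow> T \<in> B k \<or> T \<in> ?N" for u
    proof -
      have "take j (T @ [u]) = take j T" if "j \<le> k" for j using T that by simp
      moreover have "{j0..<Suc k} = insert k {j0..<k}" using step by auto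
      ultimately show ?thesis using T step by (auto simp: B_def)
    qed
    then show "(\<Sum>u\<in>nodes T. weight \<beta> T u * indicator (B (Suc k)) (T @ [u])) / W k \<le>
       indicator (B k) T + indicator ?N T"
      by (intro weighted_mean_le[OF T]) (auto split: split_indicator)
  qed
  also have "\<dots> = prob_grow k (B k) + prob_grow k ?N" by simp
  finally show ?case using step by (simp add: B_def)
qed

lemma prob_not_shallow:
  "prob_grow k {T. \<not> shallow T} \<le> exp 1 * (1 + \<beta>) * ((real k + 1) ^ 3 * exp (- ((real k + 1) powr (1 / 4))))"
proof -
  define q where "q = (real k + 1) powr (1 / 4)"
  have q4: "q ^ 4 = real k + 1" by (simp add: q_def powr_power)
  have "prob_grow k {T. \<not> shallow T} \<le> prob_grow k {T. \<exists>u\<in>nodes T. q - 1 \<le> real (depth T u)}"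
    unfolding prob_eq_mean
  proof (rule mean_grow_mono)
    fix T :: inc_tree assume T: "recursive_tree T" "length T = k"
    have "\<exists>u\<in>nodes T. q - 1 \<le> real (depth T u)" if "\<not> shallow T"
    proof -
      from that obtain u where u: "u \<in> nodes T" "(1 + depth T u) ^ 4 > k + 1"
        using T by (auto simp: shallow_def not_le)
      have "real (k + 1) \<le> real ((1 + depth T u) ^ 4)"
        using u(2) by (simp only: of_nat_le_iff less_imp_le)
      then have "q ^ 4 \<le> (1 + real (depth T u)) ^ 4" by (simp add: q4)
      then have "q \<le> 1 + real (depth T u)"
        by (rule power_mono_iff[THEN iffD1, rotated 3]) (auto simp: q_def)
      then show ?thesis using u by force
    qed
    then show "indicator {T. \<not> shallow T} T \<le> (indicator {T. \<exists>u\<in>nodes T. q - 1 \<le> real (depth T u)} T :: real)"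
      by (auto split: split_indicator)
  qed
  also have "\<dots> \<le> exp (- 1 * (q - 1)) * (W k * (real k + 1) powr (exp 1 - 1))"
    by (rule prob_deep_node) simp
  also have "\<dots> \<le> exp (- 1 * (q - 1)) * ((1 + \<beta>) * (real k + 1) * (real k + 1) powr 2)"
    using total_weight_le[of k] e_less_272 beta by (intro mult_left_mono mult_mono powr_mono) auto
  also have "\<dots> = exp 1 * (1 + \<beta>) * ((real k + 1) ^ 3 * exp (- q))"
  proof -
    have "exp (- 1 * (q - 1)) = exp 1 * exp (- q)" by (simp flip: exp_add)
    then show ?thesis by (simp add: power3_eq_cube power2_eq_square)
  qed
  finally show ?thesis by (simp add: q_def)
qed


section \<open>The tail of the deviation\<close>

text \<open>Both \<open>P / W k\<close> and its mean are nonnegative and the mean is at most \<open>log (k + 1)\<close>, which is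
  small compared with \<open>x\<close>. So a large deviation means a large average depth and hence a deep node.
  Taking \<open>exp z = sqrt x\<close> costs a factor \<open>x powr O(sqrt x)\<close> and gains \<open>exp (- x log x / 4)\<close>.\<close>

lemma early_tail:
  "\<forall>\<^sub>F x in at_top. \<forall>k. real k \<le> x ^ 8 + 1 \<longrightarrow>
     prob_grow k {T. \<not> \<bar>deviation T\<bar> \<le> x / 2} \<le> exp (- (x * ln x) / 8)"
proof -
  define c where "c = 1 + \<beta>"
  have c: "c > 0" using beta by (simp add: c_def)
  have "\<forall>\<^sub>F x in at_top. ln (x ^ 8 + 2 :: real) \<le> x / 2" by real_asymp
  moreover have "\<forall>\<^sub>F x in at_top. exp (- (x * ln x) / 4) * (c * (x ^ 8 + 2) powr sqrt x) \<le> exp (- (x * ln x) / 8)"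
    using c by real_asymp
  moreover have "\<forall>\<^sub>F x in at_top. x \<ge> (1 :: real)" by (rule eventually_ge_at_top)
  ultimately show ?thesis
  proof eventually_elim
    case (elim x)
    show ?case
    proof safe
      fix k assume k: "real k \<le> x ^ 8 + 1"
      define z where "z = ln x / 2"
      have ez: "exp z = sqrt x" using elim by (simp add: z_def ln_sqrt [symmetric])
      have deep: "\<exists>u\<in>nodes T. x / 2 \<le> real (depth T u)"
        if T: "recursive_tree T" "length T = k" and dev: "\<not> \<bar>deviation T\<bar> \<le> x / 2" for T
      proof (rule ccontr)
        assume "\<not> ?thesis"
        then have d: "real (depth T u) \<le> x / 2" if "u \<in> nodes T" for u using that by force
        have W: "W k > 0" by (rule total_weight_pos)
        have "real (internal_path_length T) = (\<Sum>u\<in>nodes T. real (depth T u))"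
          by (simp add: internal_path_length_def)
        also have "\<dots> \<le> (\<Sum>u\<in>nodes T. x / 2)" using d by (intro sum_mono) auto
        also have "\<dots> = (real k + 1) * (x / 2)" using T by (simp add: nodes_def)
        also have "\<dots> \<le> W k * (x / 2)"
          using total_weight_ge[of k] elim by (intro mult_right_mono) auto
        finally have "real (internal_path_length T) / W k \<le> x / 2"
          using W by (simp add: field_simps)
        moreover have "mean_length k / W k \<le> x / 2"
        proof -
          have "mean_length k / W k \<le> ln (real k + 1)" by (rule mean_length_upper)
          also have "\<dots> \<le> ln (x ^ 8 + 2)" using k by (subst ln_le_cancel_iff) auto
          finally show ?thesis using elim by linarith
        qed
        moreover have "0 \<le> real (internal_path_length T) / W k" using W by simp
        moreover have "0 \<le> mean_length k / W k"
          using W by (simp add: mean_length_def)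
        ultimately have "\<bar>deviation T\<bar> \<le> x / 2"
          unfolding deviation_def T(2) diff_divide_distrib by linarith
        with dev show False by simp
      qed
      have "prob_grow k {T. \<not> \<bar>deviation T\<bar> \<le> x / 2} \<le> prob_grow k {T. \<exists>u\<in>nodes T. x / 2 \<le> real (depth T u)}"
        unfolding prob_eq_mean using deep by (intro mean_grow_mono) (auto split: split_indicator)
      also have "\<dots> \<le> exp (- z * (x / 2)) * (W k * (real k + 1) powr (exp z - 1))"
        using elim by (intro prob_deep_node) (simp add: z_def)
      also have "\<dots> \<le> exp (- (x * ln x) / 4) * (c * (x ^ 8 + 2) powr sqrt x)"
      proof (rule mult_mono)
        have "W k * (real k + 1) powr (exp z - 1) \<le> c * (real k + 1) * (real k + 1) powr (exp z - 1)"
          using total_weight_le[of k] by (intro mult_right_mono) (auto simp: c_def)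
        also have "\<dots> = c * ((real k + 1) powr 1 * (real k + 1) powr (exp z - 1))" by simp
        also have "(real k + 1) powr 1 * (real k + 1) powr (exp z - 1) = (real k + 1) powr (1 + (exp z - 1))"
          by (rule powr_add [symmetric])
        also have "c * (real k + 1) powr (1 + (exp z - 1)) = c * (real k + 1) powr sqrt x"
          by (simp add: ez)
        also have "\<dots> \<le> c * (x ^ 8 + 2) powr sqrt x"
          using c k elim by (intro mult_left_mono powr_mono2) auto
        finally show "W k * (real k + 1) powr (exp z - 1) \<le> c * (x ^ 8 + 2) powr sqrt x" .
      qed (use total_weight_pos[of k] in \<open>auto simp: z_def\<close>)
      finally show "prob_grow k {T. \<not> \<bar>deviation T\<bar> \<le> x / 2} \<le> exp (- (x * ln x) / 8)"
        using elim by linarith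
    qed
  qed
qed

text \<open>The exponent \<open>8\<close> makes the fourth root of the size at least \<open>x\<^sup>2\<close>. Half of the exponent
  supplies the factor \<open>exp (- x\<^sup>2 / 2)\<close>, the other half makes the sum over all times finite.\<close>

lemma late_not_shallow:
  "\<exists>K>0. \<forall>x\<ge>0. \<forall>j0 k. x ^ 8 \<le> real j0 \<longrightarrow>
     (\<Sum>j=j0..<k. prob_grow j {T. \<not> shallow T}) \<le> K * exp (- (x\<^sup>2) / 2)"
proof -
  define A where "A = exp 1 * (1 + \<beta>)"
  have A: "A > 0" using beta by (simp add: A_def)
  define e where "e = (\<lambda>j. A * ((real j + 1) ^ 3 * exp (- ((real j + 1) powr (1 / 4)) / 2)))"
  have e0: "e j \<ge> 0" for j using A by (simp add: e_def)
  have "summable e"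
  proof (rule summable_comparison_test_bigo)
    show "summable (\<lambda>n. norm (real n powr - 2))" by (simp add: summable_real_powr_iff)
    show "e \<in> O(\<lambda>n. real n powr - 2)" unfolding e_def using A by real_asymp
  qed
  define K where "K = suminf e + 1"
  have "(\<Sum>j=j0..<k. prob_grow j {T. \<not> shallow T}) \<le> K * exp (- (x\<^sup>2) / 2)"
    if x: "x \<ge> 0" "x ^ 8 \<le> real j0" for x j0 k
  proof -
    have "prob_grow j {T. \<not> shallow T} \<le> exp (- (x\<^sup>2) / 2) * e j" if j: "j \<in> {j0..<k}" for j
    proof -
      let ?q = "(real j + 1) powr (1 / 4)"
      have "(x\<^sup>2) ^ 4 \<le> ?q ^ 4"
        using x j by (simp add: powr_power flip: power_mult)
      then have q: "x\<^sup>2 \<le> ?q" by (rule power_mono_iff[THEN iffD1, rotated 3]) auto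
      have "prob_grow j {T. \<not> shallow T} \<le> A * ((real j + 1) ^ 3 * exp (- ?q))"
        unfolding A_def by (rule prob_not_shallow)
      \<comment> \<open>one half of the exponent is kept in \<open>e\<close> for summability\<close>
      also have "exp (- ?q) = exp (- ?q / 2) * exp (- ?q / 2)" by (simp flip: exp_add)
      also have "A * ((real j + 1) ^ 3 * (exp (- ?q / 2) * exp (- ?q / 2))) = exp (- ?q / 2) * e j"
        by (simp add: e_def)
      also have "\<dots> \<le> exp (- (x\<^sup>2) / 2) * e j" using q e0 by (intro mult_right_mono) auto
      finally show ?thesis .
    qed
    then have "(\<Sum>j=j0..<k. prob_grow j {T. \<not> shallow T}) \<le> (\<Sum>j=j0..<k. exp (- (x\<^sup>2) / 2) * e j)"
      by (intro sum_mono) auto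
    also have "\<dots> = exp (- (x\<^sup>2) / 2) * (\<Sum>j=j0..<k. e j)" by (simp add: sum_distrib_left)
    also have "\<dots> \<le> exp (- (x\<^sup>2) / 2) * K"
      using sum_le_suminf[OF \<open>summable e\<close>, of "{j0..<k}"] e0
      by (intro mult_left_mono) (auto simp: K_def intro: order_trans)
    finally show ?thesis by (simp add: mult.commute)
  qed
  moreover have "K > 0" using suminf_nonneg[OF \<open>summable e\<close>] e0 by (simp add: K_def add_nonneg_pos)
  ultimately show ?thesis by blast
qed

text \<open>The growth is split at \<open>j0\<close>, the first integer above \<open>x ^ 8\<close>: up to then a deviation above \<open>x / 2\<close>
  has been excluded, and from then on the tree is shallow. Starting from at most \<open>x / 2\<close>, the
  Chernoff bound at rate \<open>\<theta> = \<plusminus> log x\<close> gains \<open>exp (- x log x / 2)\<close> and loses only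
  \<open>exp (O((log x)\<^sup>2))\<close>.\<close>

lemma deviation_tail:
  "\<forall>\<^sub>F x in at_top. \<forall>k. prob_grow k {T. x < \<bar>deviation T\<bar>} \<le> exp (- (x * ln x) / 16)"
proof -
  obtain K1 where K1: "K1 > 0" and late: "\<And>x j0 k. x \<ge> 0 \<Longrightarrow> x ^ 8 \<le> real j0 \<Longrightarrow>
     (\<Sum>j=j0..<k. prob_grow j {T. \<not> shallow T}) \<le> K1 * exp (- (x\<^sup>2) / 2)"
    using late_not_shallow by blast
  have summ: "summable (\<lambda>j. (real j + 1) powr (- 3 / 2))"
  proof -
    have "summable (\<lambda>n. real n powr (- 3 / 2))" by (subst summable_real_powr_iff) auto
    then have "summable (\<lambda>n. real (Suc n) powr (- 3 / 2))" by (subst summable_Suc_iff)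
    then show ?thesis by (simp add: add.commute)
  qed
  define K2 where "K2 = (\<Sum>j. (real j + 1) powr (- 3 / 2)) + 1"
  have K2: "K2 > 0" using suminf_nonneg[OF summ] by (simp add: K2_def add_nonneg_pos)
  have "\<forall>\<^sub>F x in at_top. exp (- (x * ln x) / 8) + K1 * exp (- (x\<^sup>2) / 2)
     + 2 * exp (K2 * (ln x)\<^sup>2 - (x * ln x) / 2) \<le> exp (- (x * ln x) / 16)"
    using K1 K2 by real_asymp
  moreover have "\<forall>\<^sub>F x in at_top. x \<ge> (1 :: real)" by (rule eventually_ge_at_top)
  ultimately show ?thesis using early_tail
  proof eventually_elim
    case (elim x)
    have early: "prob_grow k {T. \<not> \<bar>deviation T\<bar> \<le> x / 2} \<le> exp (- (x * ln x) / 8)"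
      if "real k \<le> x ^ 8 + 1" for k using elim(3) that by blast
    show ?case
    proof safe
      fix k
      define j0 where "j0 = nat \<lceil>x ^ 8\<rceil>"
      have j0: "x ^ 8 \<le> real j0" "real j0 \<le> x ^ 8 + 1" using elim by (auto simp: j0_def)
      show "prob_grow k {T. x < \<bar>deviation T\<bar>} \<le> exp (- (x * ln x) / 16)"
      proof (cases "k \<le> j0")
        case True
        have "prob_grow k {T. x < \<bar>deviation T\<bar>} \<le> prob_grow k {T. \<not> \<bar>deviation T\<bar> \<le> x / 2}"
          using elim by (intro measure_pmf.finite_measure_mono) auto
        also have "\<dots> \<le> exp (- (x * ln x) / 8)" using True j0 by (intro early) auto
        also have "\<dots> \<le> exp (- (x * ln x) / 16)" using elim by simp
        finally show ?thesis .
      next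
        case False
        define Q where "Q = (\<lambda>T. \<bar>deviation T\<bar> \<le> x / 2)"
        define G where "G = (\<lambda>T. Q (take j0 T) \<and> (\<forall>j\<in>{j0..<k}. shallow (take j T)))"
        have bad: "prob_grow k {T. \<not> G T} \<le> exp (- (x * ln x) / 8) + K1 * exp (- (x\<^sup>2) / 2)"
        proof -
          have "prob_grow k {T. \<not> G T} \<le>
              prob_grow j0 {T. \<not> Q T} + (\<Sum>j=j0..<k. prob_grow j {T. \<not> shallow T})"
            unfolding G_def using False by (intro prob_not_shallow_prefix) auto
          also have "\<dots> \<le> exp (- (x * ln x) / 8) + K1 * exp (- (x\<^sup>2) / 2)"
            unfolding Q_def using j0 elim by (intro add_mono early late) auto
          finally show ?thesis .
        qed
        have good: "prob_grow k {T. G T \<and> x < s * deviation T} \<le> exp (K2 * (ln x)\<^sup>2 - (x * ln x) / 2)"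
          if s: "\<bar>s\<bar> = 1" for s :: real
        proof -
          define \<theta> where "\<theta> = s * ln x"
          have s2: "s\<^sup>2 = 1" using s by (simp add: power2_eq_1_iff abs_if split: if_splits)
          have t2: "\<theta>\<^sup>2 = (ln x)\<^sup>2" by (simp add: \<theta>_def power_mult_distrib s2)
          have lnx: "0 \<le> ln x" "ln x \<le> x" using elim ln_le_minus_one[of x] by auto
          have "\<theta>\<^sup>2 \<le> real j0 + 1"
          proof -
            have "\<theta>\<^sup>2 \<le> x\<^sup>2" unfolding t2 using lnx by (intro power_mono) auto
            also have "\<dots> \<le> x ^ 8" using elim by (intro power_increasing) auto
            finally show ?thesis using j0 by linarith
          qed
          note moment = shallow_exp_moment[OF _ this, of k Q]
          have Qx: "\<theta> * deviation T \<le> x * ln x / 2" if "Q T" for T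
          proof -
            have "\<theta> * deviation T \<le> \<bar>\<theta>\<bar> * \<bar>deviation T\<bar>" by (metis abs_ge_self abs_mult)
            also have "\<bar>\<theta>\<bar> = ln x" using s lnx by (simp add: \<theta>_def abs_mult)
            also have "ln x * \<bar>deviation T\<bar> \<le> ln x * (x / 2)"
              using that lnx by (intro mult_left_mono) (auto simp: Q_def)
            finally show ?thesis by (simp add: mult_ac)
          qed
          have "prob_grow k {T. G T \<and> x < s * deviation T} \<le>
            mean_grow k (\<lambda>T. exp (- (x * ln x)) * (if G T then exp (\<theta> * deviation T) else 0))"
          proof (rule prob_le_mean)
            fix T assume "T \<in> {T. G T \<and> x < s * deviation T}"
            then have T: "G T" "x < s * deviation T" by auto
            have "x * ln x \<le> \<theta> * deviation T"
              using mult_right_mono[of x "s * deviation T" "ln x"] T lnx by (simp add: \<theta>_def mult_ac)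
            then show "1 \<le> exp (- (x * ln x)) * (if G T then exp (\<theta> * deviation T) else 0)"
              using T by (simp flip: exp_add)
          qed auto
          also have "\<dots> = exp (- (x * ln x)) * mean_grow k (\<lambda>T. if G T then exp (\<theta> * deviation T) else 0)"
            by simp
          also have "mean_grow k (\<lambda>T. if G T then exp (\<theta> * deviation T) else 0) \<le>
              exp (\<theta>\<^sup>2 * (\<Sum>j=j0..<k. (real j + 1) powr (- 3 / 2)))
              * mean_grow j0 (\<lambda>T. if Q T then exp (\<theta> * deviation T) else 0)"
            unfolding G_def using False by (intro moment) auto
          also have "\<dots> \<le> exp ((ln x)\<^sup>2 * K2) * exp (x * ln x / 2)"
          proof (rule mult_mono)
            have "(\<Sum>j=j0..<k. (real j + 1) powr (- 3 / 2)) \<le> K2"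
              using sum_le_suminf[OF summ, of "{j0..<k}"] by (simp add: K2_def)
            then show "exp (\<theta>\<^sup>2 * (\<Sum>j=j0..<k. (real j + 1) powr (- 3 / 2))) \<le> exp ((ln x)\<^sup>2 * K2)"
              by (simp add: t2 mult_left_mono)
            have "mean_grow j0 (\<lambda>T. if Q T then exp (\<theta> * deviation T) else 0) \<le> mean_grow j0 (\<lambda>T. exp (x * ln x / 2))"
              using Qx by (intro mean_grow_mono) auto
            then show "mean_grow j0 (\<lambda>T. if Q T then exp (\<theta> * deviation T) else 0) \<le> exp (x * ln x / 2)"
              by simp
          qed (auto intro!: integral_nonneg)
          finally have "prob_grow k {T. G T \<and> x < s * deviation T} \<le>
            exp (- (x * ln x)) * (exp ((ln x)\<^sup>2 * K2) * exp (x * ln x / 2))" by simp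
          also have "\<dots> = exp (K2 * (ln x)\<^sup>2 - (x * ln x) / 2)"
            by (simp flip: exp_add add: mult_ac)
          finally show ?thesis .
        qed
        have "prob_grow k {T. x < \<bar>deviation T\<bar>} \<le> prob_grow k ({T. \<not> G T}
            \<union> ({T. G T \<and> x < 1 * deviation T} \<union> {T. G T \<and> x < (- 1) * deviation T}))"
          by (intro measure_pmf.finite_measure_mono) (auto simp: abs_if split: if_splits)
        also have "\<dots> \<le> prob_grow k {T. \<not> G T} + (prob_grow k {T. G T \<and> x < 1 * deviation T}
            + prob_grow k {T. G T \<and> x < (- 1) * deviation T})"
          by (intro order_trans[OF measure_Un_le] add_left_mono measure_Un_le) auto
        also have "\<dots> \<le> (exp (- (x * ln x) / 8) + K1 * exp (- (x\<^sup>2) / 2))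
            + (exp (K2 * (ln x)\<^sup>2 - (x * ln x) / 2) + exp (K2 * (ln x)\<^sup>2 - (x * ln x) / 2))"
          by (intro add_mono bad good) auto
        also have "\<dots> \<le> exp (- (x * ln x) / 16)" using elim by linarith
        finally show ?thesis .
      qed
    qed
  qed
qed


end

section \<open>Comparison with the tail bound\<close>

text \<open>The first four branches are Gaussian up to constants: the second is treated by
  \<open>s \<ge> 5 \<gamma>\<close>, the fourth by the inequality \<open>L s \<le> s\<^sup>2 / 96 + 24 L\<^sup>2\<close>, where \<open>s = t / D\<close>.
  The cut-off \<open>x\<close> adds up all the thresholds, so that their order is immaterial.\<close>

lemma tail_bound_cases:
  fixes \<gamma> L D t :: real
  assumes "\<gamma> > 0" "D > 0" "t > 0"
  defines "c \<equiv> 1 / (5 * \<gamma>\<^sup>2) + 1 / 96"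
  defines "x \<equiv> 5 * \<gamma> + \<bar>48 / \<gamma> + sqrt (48 * (48 / \<gamma>\<^sup>2 - 5))\<bar> + \<bar>48 * L\<bar> + 4 * exp L"
  obtains (gaussian) "t \<le> x * D" "exp (- (c * (t / D)\<^sup>2)) \<le> tail_bound \<gamma> L D t"
    | (poisson) "4 * D * exp L < t" "tail_bound \<gamma> L D t = exp (t / D - t / D * ln (t / (4 * D)))"
proof -
  define s where "s = t / D"
  have s: "s > 0" "t = D * s" using assms by (auto simp: s_def)
  have c: "1 / (5 * \<gamma>\<^sup>2) * s\<^sup>2 \<le> c * s\<^sup>2" "1 / 96 * s\<^sup>2 \<le> c * s\<^sup>2"
    unfolding c_def by (intro mult_right_mono; simp)+
  have Deq: "48 * D / \<gamma> + D * sqrt (48 * (48 / \<gamma>\<^sup>2 - 5)) = D * (48 / \<gamma> + sqrt (48 * (48 / \<gamma>\<^sup>2 - 5)))"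
    by (simp add: algebra_simps)
  have tb: "tail_bound \<gamma> L D t =
    (if s \<le> 5 * \<gamma> then exp (- (s\<^sup>2 / (10 * \<gamma>\<^sup>2)))
     else if s \<le> 48 / \<gamma> + sqrt (48 * (48 / \<gamma>\<^sup>2 - 5)) then exp (5 / 2 - s / \<gamma>)
     else if s \<le> 48 * L then exp (- (s\<^sup>2 / 96))
     else if s \<le> 4 * exp L then exp (24 * L\<^sup>2 - L * s)
     else exp (s - s * ln (s / 4)))"
  proof -
    have "t \<le> 5 * \<gamma> * D \<longleftrightarrow> s \<le> 5 * \<gamma>" "t \<le> 48 * D * L \<longleftrightarrow> s \<le> 48 * L"
      "t \<le> 4 * D * exp L \<longleftrightarrow> s \<le> 4 * exp L"
      using assms by (auto simp: s_def field_simps)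
    moreover have "t \<le> D * (48 / \<gamma> + sqrt (48 * (48 / \<gamma>\<^sup>2 - 5))) \<longleftrightarrow> s \<le> 48 / \<gamma> + sqrt (48 * (48 / \<gamma>\<^sup>2 - 5))"
      using assms by (simp add: s_def pos_divide_le_eq mult.commute)
    moreover have "t\<^sup>2 / (10 * \<gamma>\<^sup>2 * D\<^sup>2) = s\<^sup>2 / (10 * \<gamma>\<^sup>2)" "t\<^sup>2 / (96 * D\<^sup>2) = s\<^sup>2 / 96"
      "t / (\<gamma> * D) = s / \<gamma>" "L / D * t = L * s" "t / D = s" "t / (4 * D) = s / 4"
      using assms by (simp_all add: s(2) power_mult_distrib)
    ultimately show ?thesis unfolding tail_bound_def Let_def Deq by (simp only:)
  qed
  show thesis
  proof (cases "s \<le> 5 * \<gamma> \<or> s \<le> 48 / \<gamma> + sqrt (48 * (48 / \<gamma>\<^sup>2 - 5)) \<or> s \<le> 48 * L \<or> s \<le> 4 * exp L")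
    case True
    show thesis
    proof (rule gaussian)
      have "s \<le> x"
        unfolding x_def using True assms(1) exp_gt_zero[of L]
          abs_ge_self[of "48 / \<gamma> + sqrt (48 * (48 / \<gamma>\<^sup>2 - 5))"] abs_ge_self[of "48 * L"]
          abs_ge_zero[of "48 / \<gamma> + sqrt (48 * (48 / \<gamma>\<^sup>2 - 5))"] abs_ge_zero[of "48 * L"]
        by (elim disjE) linarith+
      then show "t \<le> x * D" using assms by (simp add: s_def pos_divide_le_eq)
      have 2: "s / \<gamma> - 5 / 2 \<le> c * s\<^sup>2" if "\<not> s \<le> 5 * \<gamma>"
      proof -
        have "s * (5 * \<gamma>) \<le> s * s" using that s by (intro mult_left_mono) auto
        then have "s / \<gamma> \<le> 1 / (5 * \<gamma>\<^sup>2) * s\<^sup>2"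
          using assms by (simp add: field_simps power2_eq_square)
        then show ?thesis using c by linarith
      qed
      have 1: "s\<^sup>2 / (10 * \<gamma>\<^sup>2) \<le> c * s\<^sup>2"
      proof -
        have "s\<^sup>2 / (10 * \<gamma>\<^sup>2) \<le> s\<^sup>2 / (5 * \<gamma>\<^sup>2)"
          using assms by (intro divide_left_mono) auto
        then show ?thesis using c by simp
      qed
      have 4: "L * s - 24 * L\<^sup>2 \<le> c * s\<^sup>2"
      proof -
        have "0 \<le> (s - 48 * L)\<^sup>2 / 96" by simp
        then have "L * s - 24 * L\<^sup>2 \<le> 1 / 96 * s\<^sup>2"
          by (simp add: power2_diff power_mult_distrib field_simps)
        then show ?thesis using c by linarith
      qed
      show "exp (- (c * (t / D)\<^sup>2)) \<le> tail_bound \<gamma> L D t"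
        unfolding tb s_def[symmetric] using True 1 2 4 c(2) by auto
    qed
  next
    case False
    show thesis
    proof (rule poisson)
      show "4 * D * exp L < t"
        using False assms by (simp add: s_def pos_divide_le_eq not_le mult_ac)
      have "t / (4 * D) = s / 4" by (simp add: s_def)
      then show "tail_bound \<gamma> L D t = exp (t / D - t / D * ln (t / (4 * D)))"
        using False by (simp only: tb s_def [symmetric] de_Morgan_disj if_False)
    qed
  qed
qed

text \<open>Convexity of \<open>exp\<close> reduces the comparison on the whole range to its right end \<open>t = x D\<close>, where it
  is the hypothesis on \<open>D\<close>.\<close>

lemma cantelli_le_gaussian:
  fixes c v x D t :: real
  assumes "v > 0" "D > 0" "x > 0" "0 < t" "t \<le> x * D" and D: "v * exp (c * x\<^sup>2) \<le> x\<^sup>2 * D\<^sup>2"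
  shows "v / (v + t\<^sup>2) \<le> exp (- (c * (t / D)\<^sup>2))"
proof -
  define a where "a = c * x\<^sup>2"
  define p where "p = t\<^sup>2 / (x * D)\<^sup>2"
  have p: "0 \<le> p" "p \<le> 1" using assms by (auto simp: p_def intro!: power_mono)
  have "exp (c * (t / D)\<^sup>2) = exp ((1 - p) *\<^sub>R 0 + p *\<^sub>R a)"
    using assms by (simp add: a_def p_def power_divide power_mult_distrib)
  also have "\<dots> \<le> (1 - p) * exp 0 + p * exp a"
    using p by (intro convex_onD[OF exp_convex]) auto
  also have "\<dots> \<le> 1 + p * exp a" using p by simp
  also have "p * exp a \<le> t\<^sup>2 / v"
  proof -
    have "t\<^sup>2 * (v * exp a) \<le> t\<^sup>2 * (x\<^sup>2 * D\<^sup>2)" using D by (intro mult_left_mono) (auto simp: a_def)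
    then show ?thesis using assms by (simp add: p_def field_simps power_mult_distrib)
  qed
  finally have "exp (c * (t / D)\<^sup>2) \<le> (v + t\<^sup>2) / v" using assms by (simp add: add_divide_distrib)
  then have "inverse ((v + t\<^sup>2) / v) \<le> inverse (exp (c * (t / D)\<^sup>2))"
    by (intro le_imp_inverse_le) auto
  then show ?thesis by (simp add: exp_minus)
qed

text \<open>Both the rate \<open>1 / D\<close> and the scale \<open>4 D\<close> inside the logarithm on the right are weaker than those on
  the left.\<close>

lemma superexponential_le_poisson:
  fixes c D L t :: real
  assumes "c > 0" "L \<ge> 0" "64 * c \<le> D" "4 * D * exp L < t"
  shows "exp (- (t / c * ln (t / c)) / 16) \<le> exp (t / D - t / D * ln (t / (4 * D)))"
proof -
  have D: "D > 0" using assms by linarith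
  have "4 * D * 1 \<le> 4 * D * exp L" using assms D by (intro mult_left_mono) auto
  then have t: "4 * D < t" using assms by linarith
  have "t / D * ln (t / (4 * D)) \<le> t / c / 16 * ln (t / c)"
  proof (rule mult_mono)
    have "t / D \<le> t / (16 * c)" using assms t D by (intro divide_left_mono) auto
    then show "t / D \<le> t / c / 16" by (simp add: mult.commute)
    have "t / (4 * D) \<le> t / c" using assms t D by (intro divide_left_mono) auto
    then show "ln (t / (4 * D)) \<le> ln (t / c)"
      using assms t D by (subst ln_le_cancel_iff) auto
  qed (use assms t D in auto)
  moreover have "0 \<le> t / D" using t D by simp
  ultimately show ?thesis by simp
qed

context tree_growth begin

text \<open>The division by the size \<open>k + 1\<close> instead of \<open>W k\<close> changes the martingale by a factor between \<open>0\<close>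
  and \<open>c\<close>. The two tails are treated together through a sign \<open>s\<close>.\<close>

lemma path_length_tail_bound:
  assumes "\<gamma> > 0" "L \<ge> 0"
  shows "\<forall>\<^sub>F D in at_top. \<forall>t>0. \<forall>k.
    prob_grow k {T. (real (internal_path_length T) - mean_length k) / (real k + 1) > t} \<le> tail_bound \<gamma> L D t \<and>
    prob_grow k {T. (real (internal_path_length T) - mean_length k) / (real k + 1) < - t} \<le> tail_bound \<gamma> L D t"
proof -
  define c where "c = 1 + \<beta>"
  have c: "c > 0" using beta by (simp add: c_def)
  obtain S where S: "S > 0" "\<And>k. mean_grow k (\<lambda>T. (deviation T)\<^sup>2) \<le> S"
    using variance_bound by blast
  obtain x0 where x0: "\<And>x k. x0 \<le> x \<Longrightarrow> prob_grow k {T. x < \<bar>deviation T\<bar>} \<le> exp (- (x * ln x) / 16)"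
    using deviation_tail unfolding eventually_at_top_linorder by blast
  define v where "v = c\<^sup>2 * S"
  have v: "v > 0" using c S by (simp add: v_def)
  define C where "C = 1 / (5 * \<gamma>\<^sup>2) + 1 / 96"
  define x where "x = 5 * \<gamma> + \<bar>48 / \<gamma> + sqrt (48 * (48 / \<gamma>\<^sup>2 - 5))\<bar> + \<bar>48 * L\<bar> + 4 * exp L"
  have x: "x > 0" unfolding x_def using assms by (intro add_nonneg_pos add_nonneg_nonneg) auto
  define M where "M = v * exp (C * x\<^sup>2)"
  have M: "M > 0" using v by (simp add: M_def)
  have "\<forall>\<^sub>F D in at_top. M \<le> x\<^sup>2 * D\<^sup>2" using x M by real_asymp
  moreover have "\<forall>\<^sub>F D in at_top. 64 * c \<le> D" "\<forall>\<^sub>F D in at_top. c * x0 \<le> D"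
    "\<forall>\<^sub>F D in at_top. (0 :: real) < D"
    by (rule eventually_ge_at_top eventually_gt_at_top)+
  ultimately show ?thesis
  proof eventually_elim
    case (elim D)
    have bound: "prob_grow k {T. t < s * ((real (internal_path_length T) - mean_length k) / (real k + 1))}
        \<le> tail_bound \<gamma> L D t" if t: "t > 0" and s: "\<bar>s\<bar> = 1" for t s k
    proof -
      define r where "r = W k / (real k + 1)"
      have r: "0 \<le> r" "r \<le> c"
        using total_weight_le[of k] total_weight_pos[of k] by (auto simp: r_def c_def field_simps)
      define X where "X = (\<lambda>T. s * (r * deviation T))"
      have "prob_grow k {T. t < s * ((real (internal_path_length T) - mean_length k) / (real k + 1))}
          = prob_grow k {T. t < X T}"
        unfolding prob_eq_mean using total_weight_pos[of k]
        by (intro mean_grow_cong) (auto simp: X_def r_def deviation_def split: split_indicator)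
      also have "\<dots> \<le> tail_bound \<gamma> L D t"
        using assms(1) elim(4) t
      proof (cases rule: tail_bound_cases[where L = L])
        case gaussian
        have "mean_grow k X = 0" by (simp add: X_def mean_deviation)
        moreover have "mean_grow k (\<lambda>T. (X T)\<^sup>2) \<le> v"
        proof -
          have "s\<^sup>2 = 1" using s by (simp add: power2_eq_1_iff abs_if split: if_splits)
          then have "mean_grow k (\<lambda>T. (X T)\<^sup>2) = r\<^sup>2 * mean_grow k (\<lambda>T. (deviation T)\<^sup>2)"
            by (simp add: X_def power_mult_distrib)
          also have "\<dots> \<le> c\<^sup>2 * S"
            using S r by (intro mult_mono power_mono) auto
          finally show ?thesis by (simp add: v_def)
        qed
        ultimately have "prob_grow k {T. t < X T} \<le> v / (v + t\<^sup>2)"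
          using v t by (intro one_sided_chebyshev) auto
        also have "\<dots> \<le> exp (- (C * (t / D)\<^sup>2))"
          using v x t elim gaussian(1) by (intro cantelli_le_gaussian[of v D x]) (auto simp: M_def x_def)
        also have "\<dots> \<le> tail_bound \<gamma> L D t" using gaussian(2) by (simp add: C_def)
        finally show ?thesis .
      next
        case poisson
        have "c * x0 \<le> t"
        proof -
          have "D * 1 \<le> 4 * D * exp L" using assms elim by (intro mult_mono) auto
          then show ?thesis using poisson elim by linarith
        qed
        then have "x0 \<le> t / c" using c by (simp add: field_simps)
        have "prob_grow k {T. t < X T} \<le> prob_grow k {T. t / c < \<bar>deviation T\<bar>}"
        proof (intro measure_pmf.finite_measure_mono subsetI)
          fix T assume "T \<in> {T. t < X T}"
          then have "t < X T" by simp
          also have "\<dots> \<le> \<bar>s\<bar> * (\<bar>r\<bar> * \<bar>deviation T\<bar>)" unfolding X_def by (metis abs_ge_self abs_mult)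
          also have "\<dots> \<le> c * \<bar>deviation T\<bar>" using s r by (simp add: mult_right_mono)
          finally show "T \<in> {T. t / c < \<bar>deviation T\<bar>}" using c by (simp add: field_simps)
        qed auto
        also have "\<dots> \<le> exp (- (t / c * ln (t / c)) / 16)" by (rule x0) fact
        also have "\<dots> \<le> tail_bound \<gamma> L D t"
          unfolding poisson(2) using c assms elim poisson(1) by (intro superexponential_le_poisson) auto
        finally show ?thesis .
      qed
      finally show ?thesis .
    qed
    show ?case
    proof (intro allI impI conjI)
      fix t :: real and k assume "t > 0"
      show "prob_grow k {T. (real (internal_path_length T) - mean_length k) / (real k + 1) > t} \<le> tail_bound \<gamma> L D t"
        using bound[OF \<open>t > 0\<close>, of 1 k] by simp
      show "prob_grow k {T. (real (internal_path_length T) - mean_length k) / (real k + 1) < - t} \<le> tail_bound \<gamma> L D t"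
      proof -
        have "(t < - 1 * y) = (y < - t)" for y :: real by auto
        from bound[OF \<open>t > 0\<close>, of "- 1" k, unfolded this] show ?thesis by simp
      qed
    qed
  qed
qed

text \<open>In terms of \<open>x = t log (k + 1) / (2 c\<^sup>2)\<close>, a lower bound for \<open>t E[P] / W k\<close>, the exponent to be
  reached is \<open>(2 c x / D) log (c x / (2 D e))\<close>, which is at most \<open>x log x / 32\<close> when \<open>D \<ge> 64 c\<close>.\<close>

lemma path_length_relative_deviation:
  fixes D t :: real
  assumes D: "64 * (1 + \<beta>) \<le> D" and t: "t > 0"
  defines "\<alpha> \<equiv> - ln (4 * D * (1 + \<beta>) * exp 1)"
  shows "\<forall>\<^sub>F k in sequentially.
    prob_grow k {T. \<bar>real (internal_path_length T) - mean_length k\<bar> > t * mean_length k}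
    \<le> exp (- (1 / (1 + \<beta>) * (1 / D) * t * ln (real k + 1) * (ln (ln (real k + 1)) + ln t + \<alpha>)))"
proof -
  define c where "c = 1 + \<beta>"
  have c: "c > 0" "64 * c \<le> D" using beta D by (auto simp: c_def)
  have Dpos: "D > 0" using c by linarith
  obtain x0 where x0: "\<And>x k. x0 \<le> x \<Longrightarrow> prob_grow k {T. x < \<bar>deviation T\<bar>} \<le> exp (- (x * ln x) / 16)"
    using deviation_tail unfolding eventually_at_top_linorder by blast
  have "\<forall>\<^sub>F k in sequentially. ln (real k + 1) / 2 \<le> ln ((real k + 2) / 2)" by real_asymp
  moreover have "\<forall>\<^sub>F k in sequentially. ln (real k + 1) > 0" by real_asymp
  moreover have lim: "filterlim (\<lambda>k. t * ln (real k + 1) / (2 * c\<^sup>2)) at_top sequentially"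
    using c t by real_asymp
  have "\<forall>\<^sub>F k in sequentially. t * ln (real k + 1) / (2 * c\<^sup>2) \<ge> max 1 x0"
    using lim unfolding filterlim_at_top by blast
  ultimately show ?thesis
  proof eventually_elim
    case (elim k)
    define x where "x = t * ln (real k + 1) / (2 * c\<^sup>2)"
    have x: "x \<ge> 1" "x \<ge> x0" using elim by (auto simp: x_def)
    have W: "W k > 0" by (rule total_weight_pos)
    have mean: "x \<le> t * (mean_length k / W k)"
    proof -
      have "x = t * (ln (real k + 1) / 2 / c\<^sup>2)" by (simp add: x_def)
      also have "\<dots> \<le> t * (ln ((real k + 2) / 2) / c\<^sup>2)"
        using elim t by (intro mult_left_mono divide_right_mono) auto
      also have "\<dots> \<le> t * (mean_length k / W k)"
        using mean_length_lower[of k] t by (intro mult_left_mono) (auto simp: c_def)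
      finally show ?thesis .
    qed
    have "prob_grow k {T. \<bar>real (internal_path_length T) - mean_length k\<bar> > t * mean_length k}
        \<le> prob_grow k {T. x < \<bar>deviation T\<bar>}"
      unfolding prob_eq_mean
    proof (rule mean_grow_mono)
      fix T :: inc_tree assume T: "length T = k"
      have "x < \<bar>deviation T\<bar>" if "t * mean_length k < \<bar>real (internal_path_length T) - mean_length k\<bar>"
      proof -
        have "t * mean_length k / W k < \<bar>real (internal_path_length T) - mean_length k\<bar> / W k"
          using that W by (rule divide_strict_right_mono)
        also have "\<dots> = \<bar>deviation T\<bar>" using T W by (simp add: deviation_def)
        finally show ?thesis using mean by simp
      qed
      then show "indicator {T. t * mean_length k < \<bar>real (internal_path_length T) - mean_length k\<bar>} T
        \<le> (indicator {T. x < \<bar>deviation T\<bar>} T :: real)" by (auto split: split_indicator)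
    qed
    also have "\<dots> \<le> exp (- (x * ln x) / 16)" using x by (intro x0)
    also have "\<dots> \<le> exp (- (1 / c * (1 / D) * t * ln (real k + 1) * (ln (ln (real k + 1)) + ln t + \<alpha>)))"
    proof -
      have "ln (ln (real k + 1)) + ln t = ln (2 * c\<^sup>2 * x)"
        using elim t c by (simp add: x_def ln_mult)
      then have "ln (ln (real k + 1)) + ln t + \<alpha> = ln (2 * c\<^sup>2 * x / (4 * D * c * exp 1))"
        using c x Dpos unfolding \<alpha>_def c_def[symmetric] by (subst ln_div) auto
      also have "\<dots> \<le> ln x"
      proof (subst ln_le_cancel_iff)
        have "c * 1 \<le> D * exp 1" using c Dpos by (intro mult_mono) auto
        then have "c \<le> 2 * D * exp 1" using c by simp
        then have "c * (2 * c * x) \<le> (2 * D * exp 1) * (2 * c * x)"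
          using c x by (intro mult_right_mono) auto
        then show "2 * c\<^sup>2 * x / (4 * D * c * exp 1) \<le> x"
          using c Dpos by (simp add: pos_divide_le_eq power2_eq_square mult_ac)
      qed (use c x Dpos in auto)
      finally have log: "ln (ln (real k + 1)) + ln t + \<alpha> \<le> ln x" .
      have eq: "1 / c * (1 / D) * t * ln (real k + 1) = 2 * c / D * x"
        using c by (simp add: x_def power2_eq_square)
      have "1 / c * (1 / D) * t * ln (real k + 1) * (ln (ln (real k + 1)) + ln t + \<alpha>)
          \<le> 2 * c / D * x * ln x"
        unfolding eq using log c x Dpos by (intro mult_left_mono) auto
      also have "\<dots> \<le> 1 / 16 * x * ln x"
        using c Dpos x by (intro mult_right_mono) (auto simp: pos_divide_le_eq)
      finally show ?thesis by simp
    qed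
    finally show ?case unfolding c_def .
  qed
qed

end

section \<open>The internal path length of random linear recursive trees\<close>

theorem corollary1p4:
  fixes b :: nat and \<gamma> L\<^sub>0 :: real
  assumes b: "b \<ge> 2"
    and gamma: "\<gamma> > 0" "12 / 7 = exp (2 / \<gamma>) - 2 / \<gamma>"
    and L0: "exp L\<^sub>0 = 6 * L\<^sub>0\<^sup>2" "\<forall>L::real. exp L = 6 * L\<^sup>2 \<longrightarrow> L \<le> L\<^sub>0"
  shows "\<exists>D::real. D > 0 \<and>
    (\<forall>t::real. \<forall>n::nat. t > 0 \<longrightarrow> n \<ge> 1 \<longrightarrow>
       measure_pmf.prob (linear_recursive_tree (real b - 2) n)
         {T. (real (internal_path_length T) - mean_path_length (real b - 2) n) / real n > t}
         \<le> tail_bound \<gamma> L\<^sub>0 D t \<and>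
       measure_pmf.prob (linear_recursive_tree (real b - 2) n)
         {T. (real (internal_path_length T) - mean_path_length (real b - 2) n) / real n < - t}
         \<le> tail_bound \<gamma> L\<^sub>0 D t) \<and>
    (let \<alpha> = - ln (4 * D * (real b - 1) * exp 1) in \<forall>t::real. t > 0 \<longrightarrow>
       (\<exists>\<epsilon> :: nat \<Rightarrow> real. \<epsilon> \<longlonglongrightarrow> 0 \<and>
         (\<forall>\<^sub>F n in sequentially.
            measure_pmf.prob (linear_recursive_tree (real b - 2) n)
              {T. \<bar>real (internal_path_length T) - mean_path_length (real b - 2) n\<bar>
                    > t * mean_path_length (real b - 2) n}
            \<le> exp (- (1 / (real b - 1) * (1 / D) * t * ln (real n) *
                (ln (ln (real n)) + ln t + \<alpha> + \<epsilon> n))))))"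
proof -
  interpret tree_growth "real b - 2"
    using b by unfold_locales simp
  have mean: "mean_path_length (real b - 2) n = mean_length (n - 1)" for n
    by (simp add: mean_path_length_def linear_recursive_tree_def mean_length_def)
  have L: "L\<^sub>0 \<ge> 0"
  proof -
    \<comment> \<open>the equation has a root in \<open>[0, 1]\<close>, so its largest root is nonnegative\<close>
    have "\<exists>x\<ge>0. x \<le> 1 \<and> 6 * x\<^sup>2 - exp x = (0::real)"
      using e_less_272 by (intro IVT') (auto intro!: continuous_intros)
    then obtain x :: real where "x \<ge> 0" "exp x = 6 * x\<^sup>2" by auto
    then show ?thesis using L0(2) by force
  qed
  have large: "\<forall>\<^sub>F D in at_top. 64 * (real b - 1) \<le> D \<and> 0 < D"
    by (intro eventually_conj eventually_ge_at_top eventually_gt_at_top)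
  have "\<forall>\<^sub>F D in at_top. (64 * (real b - 1) \<le> D \<and> 0 < D) \<and>
    (\<forall>t>0. \<forall>k.
      measure_pmf.prob (grow (real b - 2) k) {T. (real (internal_path_length T) - mean_length k) / (real k + 1) > t}
        \<le> tail_bound \<gamma> L\<^sub>0 D t \<and>
      measure_pmf.prob (grow (real b - 2) k) {T. (real (internal_path_length T) - mean_length k) / (real k + 1) < - t}
        \<le> tail_bound \<gamma> L\<^sub>0 D t)"
    by (rule eventually_conj[OF large path_length_tail_bound[OF gamma(1) L]])
  then obtain D where D: "64 * (real b - 1) \<le> D" "0 < D"
    and tails: "\<And>t k. t > 0 \<Longrightarrow>
      measure_pmf.prob (grow (real b - 2) k) {T. (real (internal_path_length T) - mean_length k) / (real k + 1) > t}
        \<le> tail_bound \<gamma> L\<^sub>0 D t"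
      "\<And>t k. t > 0 \<Longrightarrow>
      measure_pmf.prob (grow (real b - 2) k) {T. (real (internal_path_length T) - mean_length k) / (real k + 1) < - t}
        \<le> tail_bound \<gamma> L\<^sub>0 D t"
    unfolding eventually_at_top_linorder by blast
  show ?thesis
    unfolding Let_def mean linear_recursive_tree_def
  proof (intro exI[of _ D] conjI allI impI)
    show "D > 0" by fact
  next
    fix t :: real and n :: nat assume t: "t > 0" and n: "n \<ge> 1"
    have n': "real (n - 1) + 1 = real n" using n by simp
    show "measure_pmf.prob (grow (real b - 2) (n - 1))
       {T. t < (real (internal_path_length T) - mean_length (n - 1)) / real n} \<le> tail_bound \<gamma> L\<^sub>0 D t"
      using tails(1)[OF t, of "n - 1"] unfolding n' .
    show "measure_pmf.prob (grow (real b - 2) (n - 1))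
       {T. (real (internal_path_length T) - mean_length (n - 1)) / real n < - t} \<le> tail_bound \<gamma> L\<^sub>0 D t"
      using tails(2)[OF t, of "n - 1"] unfolding n' .
  next
    fix t :: real assume t: "t > 0"
    have b1: "1 + (real b - 2) = real b - 1" by simp
    have "\<forall>\<^sub>F k in sequentially. measure_pmf.prob (grow (real b - 2) k)
        {T. \<bar>real (internal_path_length T) - mean_length k\<bar> > t * mean_length k}
      \<le> exp (- (1 / (real b - 1) * (1 / D) * t * ln (real k + 1) *
           (ln (ln (real k + 1)) + ln t + - ln (4 * D * (real b - 1) * exp 1))))"
      using path_length_relative_deviation[of D t] D t unfolding b1 by simp
    then obtain N where N: "\<And>k. k \<ge> N \<Longrightarrow> measure_pmf.prob (grow (real b - 2) k)
        {T. \<bar>real (internal_path_length T) - mean_length k\<bar> > t * mean_length k}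
      \<le> exp (- (1 / (real b - 1) * (1 / D) * t * ln (real k + 1) *
           (ln (ln (real k + 1)) + ln t + - ln (4 * D * (real b - 1) * exp 1))))"
      unfolding eventually_sequentially by blast
    show "\<exists>\<epsilon> :: nat \<Rightarrow> real. \<epsilon> \<longlonglongrightarrow> 0 \<and> (\<forall>\<^sub>F n in sequentially.
        measure_pmf.prob (grow (real b - 2) (n - 1))
          {T. t * mean_length (n - 1) < \<bar>real (internal_path_length T) - mean_length (n - 1)\<bar>}
        \<le> exp (- (1 / (real b - 1) * (1 / D) * t * ln (real n) *
             (ln (ln (real n)) + ln t + - ln (4 * D * (real b - 1) * exp 1) + \<epsilon> n))))"
    proof (intro exI[of _ "\<lambda>_. 0"] conjI)
      show "\<forall>\<^sub>F n in sequentially.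
        measure_pmf.prob (grow (real b - 2) (n - 1))
          {T. t * mean_length (n - 1) < \<bar>real (internal_path_length T) - mean_length (n - 1)\<bar>}
        \<le> exp (- (1 / (real b - 1) * (1 / D) * t * ln (real n) *
             (ln (ln (real n)) + ln t + - ln (4 * D * (real b - 1) * exp 1) + 0)))"
        unfolding eventually_sequentially
      proof (intro exI[of _ "Suc N"] allI impI)
        fix n assume n: "Suc N \<le> n"
        then have n': "real (n - 1) + 1 = real n" by simp
        show "measure_pmf.prob (grow (real b - 2) (n - 1))
          {T. t * mean_length (n - 1) < \<bar>real (internal_path_length T) - mean_length (n - 1)\<bar>}
        \<le> exp (- (1 / (real b - 1) * (1 / D) * t * ln (real n) *
             (ln (ln (real n)) + ln t + - ln (4 * D * (real b - 1) * exp 1) + 0)))"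
          using N[of "n - 1"] n unfolding n' by simp
      qed
    qed simp
  qed
qed

end
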